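(* There is an algorithm running in time polynomial in $n$ and $|\mathcal{S}|$ which, given an instance of the single-option optimal search problem, computes a (possibly randomized) partially-adaptive strategy whose expected total cost is at most $(3+2\sqrt{2})\frac{e}{e-1}\approx 9.22$ times the minimum expected total cost of any partially-adaptive strategy.
   Context: Optimal search problem (single option, unit probing times). There are $n$ boxes $\mathcal{B}=\{1,\dots,n\}$ and a finite list $\mathcal{S}$ of scenarios; the true scenario $s$ is drawn uniformly at random from $\mathcal{S}$ and is unknown. In scenario $s$, box $i$ has cost $c_{is}\ge 0$. Probing a box takes one unit of time and reveals its cost in the realized scenario. A strategy probes boxes, then stops and selects a probed box; its total cost is the number of probes plus the cost of the selected box, evaluated in expectation. A partially-adaptive strategy probes boxes in a fixed order that does not depend on the observed costs, but may decide when to stop based arbitrarily on the costs observed so far (and then selects a cheapest probed box). *)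

theory Defs
  imports "HOL-Probability.Probability" "HOL-Computational_Algebra.Polynomial"
begin

section \<open>The search problem\<close>

text \<open>Boxes and scenarios are numbered from 0. Scenario s is the list of the costs of all boxes;
  equal scenarios may occur several times in the list.\<close>

record search_instance =
  boxes :: nat
  scenarios :: "real list list"

abbreviation num_scens :: "search_instance \<Rightarrow> nat" where
  "num_scens I \<equiv> length (scenarios I)"

definition cost :: "search_instance \<Rightarrow> nat \<Rightarrow> nat \<Rightarrow> real" where
  "cost I i s = scenarios I ! s ! i"

definition valid_instance :: "search_instance \<Rightarrow> bool" where
  "valid_instance I \<longleftrightarrow> boxes I \<ge> 1 \<and> scenarios I \<noteq> [] \<and>
     (\<forall>xs\<in>set (scenarios I). length xs = boxes I \<and> (\<forall>x\<in>set xs. x \<ge> 0))"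

text \<open>The stopping rule is an arbitrary predicate on the list of costs observed so far.
  At least one box is probed, and probing ends at the latest when all boxes have been probed.\<close>

record pa_strategy =
  probe_order :: "nat list"
  stop :: "real list \<Rightarrow> bool"

definition valid_strategy :: "search_instance \<Rightarrow> pa_strategy \<Rightarrow> bool" where
  "valid_strategy I \<sigma> \<longleftrightarrow> distinct (probe_order \<sigma>) \<and> set (probe_order \<sigma>) = {..<boxes I}"

definition observed :: "search_instance \<Rightarrow> nat list \<Rightarrow> nat \<Rightarrow> nat \<Rightarrow> real list" where
  "observed I xs s t = map (\<lambda>i. cost I i s) (take t xs)"

definition num_probes :: "search_instance \<Rightarrow> pa_strategy \<Rightarrow> nat \<Rightarrow> nat" where
  "num_probes I \<sigma> s =
     (LEAST t. t \<ge> 1 \<and> (stop \<sigma> (observed I (probe_order \<sigma>) s t) \<or> t \<ge> boxes I))"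

definition total_cost :: "search_instance \<Rightarrow> pa_strategy \<Rightarrow> nat \<Rightarrow> real" where
  "total_cost I \<sigma> s = real (num_probes I \<sigma> s) +
     Min (set (observed I (probe_order \<sigma>) s (num_probes I \<sigma> s)))"

definition expected_cost :: "search_instance \<Rightarrow> pa_strategy \<Rightarrow> real" where
  "expected_cost I \<sigma> =
     measure_pmf.expectation (pmf_of_set {..<num_scens I}) (total_cost I \<sigma>)"

text \<open>A randomized strategy is a distribution over deterministic ones, chosen independently of
  the scenario. The optimum over randomized strategies is the one over deterministic strategies.\<close>

definition rand_expected_cost :: "search_instance \<Rightarrow> pa_strategy pmf \<Rightarrow> real" where
  "rand_expected_cost I R = measure_pmf.expectation R (expected_cost I)"

definition pa_opt :: "search_instance \<Rightarrow> real" where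
  "pa_opt I = (INF \<sigma>\<in>{\<sigma>. valid_strategy I \<sigma>}. expected_cost I \<sigma>)"


section \<open>Algorithms: randomized programs for a unit-cost real RAM\<close>

text \<open>Programs work on natural-number arrays and real arrays (a scalar is an array of which only
  index 0 is used). Naturals serve as indices and have no unit-cost multiplication; reals have exact
  field operations and comparisons but no rounding, and the only constants are natural numbers:
  unit-cost integer multiplication and real constants would both add computational power.
  The expressions of a fixed program have bounded size, so evaluating one costs a single step.\<close>

type_synonym vname = string

datatype nexp =
    Const nat
  | NumBoxes
  | NumScens
  | NGet vname nexp
  | NPlus nexp nexp
  | NMinus nexp nexp

datatype rexp =
    OfNat nexp
  | Cost nexp nexp
  | RGet vname nexp
  | RPlus rexp rexp
  | RMinus rexp rexp
  | RTimes rexp rexp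
  | RDiv rexp rexp

datatype bexp =
    NLess nexp nexp
  | RLess rexp rexp
  | BNot bexp
  | BAnd bexp bexp

text \<open>\<open>Flip x a r\<close> stores 1 with probability r (clamped to the unit interval)
  and 0 otherwise in cell a of the natural-number array x.\<close>

datatype com =
    Skip
  | NAssign vname nexp nexp
  | RAssign vname nexp rexp
  | Flip vname nexp rexp
  | Seq com com
  | Cond bexp com com
  | While bexp com

record state =
  nats :: "vname \<Rightarrow> nat \<Rightarrow> nat"
  reals :: "vname \<Rightarrow> nat \<Rightarrow> real"

definition init_state :: state where
  "init_state = \<lparr>nats = (\<lambda>_ _. 0), reals = (\<lambda>_ _. 0)\<rparr>"

definition set_nat :: "vname \<Rightarrow> nat \<Rightarrow> nat \<Rightarrow> state \<Rightarrow> state" where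
  "set_nat x a v st = st\<lparr>nats := (nats st)(x := (nats st x)(a := v))\<rparr>"

definition set_real :: "vname \<Rightarrow> nat \<Rightarrow> real \<Rightarrow> state \<Rightarrow> state" where
  "set_real x a v st = st\<lparr>reals := (reals st)(x := (reals st x)(a := v))\<rparr>"

primrec nval :: "search_instance \<Rightarrow> state \<Rightarrow> nexp \<Rightarrow> nat" where
  "nval I st (Const k) = k"
| "nval I st NumBoxes = boxes I"
| "nval I st NumScens = num_scens I"
| "nval I st (NGet x a) = nats st x (nval I st a)"
| "nval I st (NPlus a b) = nval I st a + nval I st b"
| "nval I st (NMinus a b) = nval I st a - nval I st b"

primrec rval :: "search_instance \<Rightarrow> state \<Rightarrow> rexp \<Rightarrow> real" where
  "rval I st (OfNat a) = real (nval I st a)"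
| "rval I st (Cost i s) =
     (if nval I st i < boxes I \<and> nval I st s < num_scens I
      then cost I (nval I st i) (nval I st s) else 0)"
| "rval I st (RGet x a) = reals st x (nval I st a)"
| "rval I st (RPlus a b) = rval I st a + rval I st b"
| "rval I st (RMinus a b) = rval I st a - rval I st b"
| "rval I st (RTimes a b) = rval I st a * rval I st b"
| "rval I st (RDiv a b) = rval I st a / rval I st b"

primrec bval :: "search_instance \<Rightarrow> state \<Rightarrow> bexp \<Rightarrow> bool" where
  "bval I st (NLess a b) \<longleftrightarrow> nval I st a < nval I st b"
| "bval I st (RLess a b) \<longleftrightarrow> rval I st a < rval I st b"
| "bval I st (BNot b) \<longleftrightarrow> \<not> bval I st b"
| "bval I st (BAnd b c) \<longleftrightarrow> bval I st b \<and> bval I st c"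

type_synonym config = "com \<times> state"

primrec step :: "search_instance \<Rightarrow> com \<Rightarrow> state \<Rightarrow> config pmf" where
  "step I Skip st = return_pmf (Skip, st)"
| "step I (NAssign x a e) st =
     return_pmf (Skip, set_nat x (nval I st a) (nval I st e) st)"
| "step I (RAssign x a e) st =
     return_pmf (Skip, set_real x (nval I st a) (rval I st e) st)"
| "step I (Flip x a r) st =
     map_pmf (\<lambda>b. (Skip, set_nat x (nval I st a) (if b then 1 else 0) st))
       (bernoulli_pmf (rval I st r))"
| "step I (Seq c d) st =
     (if c = Skip then return_pmf (d, st)
      else map_pmf (\<lambda>(c', st'). (Seq c' d, st')) (step I c st))"
| "step I (Cond b c d) st = return_pmf (if bval I st b then c else d, st)"
| "step I (While b c) st = return_pmf (Cond b (Seq c (While b c)) Skip, st)"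

primrec run :: "search_instance \<Rightarrow> com \<Rightarrow> nat \<Rightarrow> config pmf" where
  "run I c 0 = return_pmf (c, init_state)"
| "run I c (Suc k) = bind_pmf (run I c k) (\<lambda>(c', st). step I c' st)"

definition halts_within :: "search_instance \<Rightarrow> com \<Rightarrow> nat \<Rightarrow> bool" where
  "halts_within I c k \<longleftrightarrow> (\<forall>cfg\<in>set_pmf (run I c k). fst cfg = Skip)"

text \<open>A program describes its output strategy by the order of the boxes and, for every scenario s,
  a time by which to stop if the scenario is s. As the rule only sees costs, the strategy
  stops at time t if some scenario consistent with the costs observed up to t has its stopping
  time at or before t. Every partially-adaptive strategy has the same run in each scenario as one
  described in this way.\<close>

definition output_strategy :: "search_instance \<Rightarrow> state \<Rightarrow> pa_strategy" where
  "output_strategy I st =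
     (let xs = map (nats st ''order'') [0..<boxes I] in
      \<lparr>probe_order = xs,
       stop = (\<lambda>h. \<exists>s<num_scens I.
          observed I xs s (length h) = h \<and> nats st ''stop'' s \<le> length h)\<rparr>)"

definition output_distribution :: "search_instance \<Rightarrow> com \<Rightarrow> nat \<Rightarrow> pa_strategy pmf" where
  "output_distribution I c k = map_pmf (\<lambda>(_, st). output_strategy I st) (run I c k)"

end

theory Submission
  imports Defs
begin

text \<open>No linear program is needed: a deterministic greedy rule loses a factor of at most 6, and
  \<open>6 \<le> (3 + 2 * sqrt 2) * (e / (e - 1))\<close>. While the set R of uncovered scenarios is nonempty, choose a box i and
  a threshold (the cost of i in a scenario r) such that the set A of the scenarios in R whose cost
  in i is at most the threshold minimises (|R| + sum of the costs of i over A) / |A|, and stop in the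
  scenarios of A. The thresholds depend only on the number of probes, so this stopping rule is
  non-anticipating although the program computes it per scenario. Charging every scenario of A
  this minimum, its price, accounts for the whole cost. By minimality, no box saves the scenarios of R more
  than |R| in total with respect to the price, so that any other strategy serves at most half of R at less than a
  third of the price. Integrating over the prices gives the factor 2 * 3. A box may be chosen again with a
  higher threshold; the second probe is charged although it is free.\<close>

section \<open>The greedy rule\<close>

text \<open>Layer-cake argument: a nonnegative \<open>y\<close> is the integral of the indicator of
  \<open>{0..<y}\<close>, so a sum is the integral over \<open>x\<close> of the counts of its
  superlevel sets, and these counts are compared pointwise. Values at different elements are thereby
  compared without any matching of elements.\<close>

lemma sum_le_of_card_superlevel:
  fixes f g :: "'a \<Rightarrow> real"
  assumes fin: "finite S" and nn: "\<And>s. s \<in> S \<Longrightarrow> 0 \<le> f s" "\<And>s. s \<in> S \<Longrightarrow> 0 \<le> g s"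
    and le: "\<And>x. 0 \<le> x \<Longrightarrow> real (card {s\<in>S. x < f s}) \<le> C * real (card {s\<in>S. x < g s})"
  shows "sum f S \<le> C * sum g S"
proof -
  define ind :: "real \<Rightarrow> real \<Rightarrow> real" where "ind y = indicator {0..<y}" for y
  have cnt: "(\<Sum>s\<in>S. ind (k s) x) = real (card {s\<in>S. x < k s})" if "0 \<le> x" for k x
  proof -
    have "(\<Sum>s\<in>S. ind (k s) x) = (\<Sum>s\<in>S. if x < k s then 1 else 0)"
      using that by (intro sum.cong) (auto simp: ind_def)
    also have "\<dots> = real (card {s\<in>S. x < k s})"
      using fin by (simp flip: sum.inter_filter)
    finally show ?thesis .
  qed
  have integrable: "integrable lborel (ind y)" for y
    unfolding ind_def by (cases "0 \<le> y") (auto intro!: integrable_real_indicator)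
  have val: "(\<integral>x. ind y x \<partial>lborel) = y" if "0 \<le> y" for y
    using that by (simp add: ind_def)
  have "sum f S = (\<integral>x. (\<Sum>s\<in>S. ind (f s) x) \<partial>lborel)"
    using nn by (simp add: integrable val Bochner_Integration.integral_sum)
  also have "\<dots> \<le> (\<integral>x. C * (\<Sum>s\<in>S. ind (g s) x) \<partial>lborel)"
  proof (intro integral_mono)
    show "(\<Sum>s\<in>S. ind (f s) x) \<le> C * (\<Sum>s\<in>S. ind (g s) x)" for x
    proof (cases "0 \<le> x")
      case True
      then show ?thesis using le[OF True] by (simp add: cnt)
    qed (simp add: ind_def)
  qed (auto intro!: integrable)
  also have "\<dots> = C * sum g S"
    using nn by (simp add: integrable val Bochner_Integration.integral_sum)
  finally show ?thesis .
qed

section \<open>Greedy histories, payments and prices\<close>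

definition covered :: "search_instance \<Rightarrow> nat set \<Rightarrow> nat \<Rightarrow> nat \<Rightarrow> nat set" where
  "covered I R i r = {s\<in>R. cost I i s \<le> cost I i r}"

definition weight :: "search_instance \<Rightarrow> nat set \<Rightarrow> nat \<Rightarrow> nat \<Rightarrow> real" where
  "weight I R i r = real (card R) + (\<Sum>s\<in>covered I R i r. cost I i s)"

text \<open>Minimality of the ratio is cross-multiplied, so that pairs covering nothing cause no
  division by 0. An empty \<open>R\<close> leaves only the range condition on the box, as the main
  loop may run on after all scenarios have been covered.\<close>

definition greedy_choice :: "search_instance \<Rightarrow> nat set \<Rightarrow> nat \<Rightarrow> nat \<Rightarrow> bool" where
  "greedy_choice I R i r \<longleftrightarrow> i < boxes I \<and> (R \<noteq> {} \<longrightarrow> covered I R i r \<noteq> {} \<and>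
     (\<forall>j<boxes I. \<forall>q<num_scens I.
        weight I R i r * card (covered I R j q) \<le> weight I R j q * card (covered I R i r)))"

fun greedy :: "search_instance \<Rightarrow> nat set \<Rightarrow> (nat \<times> nat) list \<Rightarrow> bool" where
  "greedy I R [] \<longleftrightarrow> True"
| "greedy I R ((i, r) # h) \<longleftrightarrow> greedy_choice I R i r \<and> greedy I (R - covered I R i r) h"

definition remaining :: "search_instance \<Rightarrow> nat set \<Rightarrow> (nat \<times> nat) list \<Rightarrow> nat set" where
  "remaining I R h = {s\<in>R. \<forall>(i, r)\<in>set h. \<not> cost I i s \<le> cost I i r}"

text \<open>An upper bound for the output strategy: a pair costs a probe even if its box is not new,
  and the box of the covering pair is selected even if a cheaper one has been probed.\<close>

fun paid :: "search_instance \<Rightarrow> (nat \<times> nat) list \<Rightarrow> nat \<Rightarrow> real" where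
  "paid I [] s = 0"
| "paid I ((i, r) # h) s = 1 + (if cost I i s \<le> cost I i r then cost I i s else paid I h s)"

fun price :: "search_instance \<Rightarrow> nat set \<Rightarrow> (nat \<times> nat) list \<Rightarrow> nat \<Rightarrow> real" where
  "price I R [] s = 0"
| "price I R ((i, r) # h) s =
     (if cost I i s \<le> cost I i r then weight I R i r / card (covered I R i r)
      else price I (R - covered I R i r) h s)"

lemma covered_subset: "covered I R i r \<subseteq> R"
  by (auto simp: covered_def)

lemma remaining_Nil [simp]: "remaining I R [] = R"
  by (simp add: remaining_def)

lemma remaining_Cons: "remaining I R ((i, r) # h) = remaining I (R - covered I R i r) h"
  by (auto simp: remaining_def covered_def)

lemma remaining_snoc:
  "remaining I R (h @ [(i, r)]) = remaining I R h - covered I (remaining I R h) i r"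
  by (auto simp: remaining_def covered_def)

lemma greedy_snoc:
  "greedy I R (h @ [(i, r)]) \<longleftrightarrow> greedy I R h \<and> greedy_choice I (remaining I R h) i r"
  by (induction I R h rule: greedy.induct) (auto simp: remaining_Cons)

lemma paid_append:
  assumes "s \<in> remaining I R h" "cost I i s \<le> cost I i r"
  shows "paid I (h @ (i, r) # h') s = real (Suc (length h)) + cost I i s"
  using assms by (induction h) (auto simp: remaining_def)

text \<open>Double counting: each scenario in \<open>R\<close> pays one probe for the head pair, and
  the covered ones also pay for its box. These payments add up to the \<open>weight\<close>, which
  the prices spread evenly over the covered scenarios.\<close>

lemma sum_paid_eq_sum_price:
  assumes "greedy I R h" "finite R" "remaining I R h = {}"
  shows "(\<Sum>s\<in>R. paid I h s) = (\<Sum>s\<in>R. price I R h s)"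
  using assms
proof (induction I R h rule: greedy.induct)
  case (1 I R)
  then show ?case by simp
next
  case (2 I R i r h)
  define K where "K = covered I R i r"
  have K: "K \<subseteq> R" "finite K" using 2 finite_subset by (auto simp: K_def covered_def)
  have split: "sum f R = sum f K + sum f (R - K)" for f :: "nat \<Rightarrow> real"
    using K 2 by (metis add.commute sum.subset_diff)
  have IH: "(\<Sum>s\<in>R - K. paid I h s) = (\<Sum>s\<in>R - K. price I (R - K) h s)"
    using 2 by (simp add: K_def remaining_Cons)
  have cov: "s \<in> K \<longleftrightarrow> cost I i s \<le> cost I i r" if "s \<in> R" for s
    using that by (auto simp: K_def covered_def)
  have "(\<Sum>s\<in>R. paid I ((i, r) # h) s)
      = real (card R) + (\<Sum>s\<in>R. if cost I i s \<le> cost I i r then cost I i s else paid I h s)"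
    by (simp add: sum.distrib)
  also have "(\<Sum>s\<in>R. if cost I i s \<le> cost I i r then cost I i s else paid I h s)
      = (\<Sum>s\<in>K. cost I i s) + (\<Sum>s\<in>R - K. paid I h s)"
    unfolding split using cov K by (intro arg_cong2[where f="(+)"] sum.cong) auto
  also have "real (card R) + \<dots> = weight I R i r + (\<Sum>s\<in>R - K. price I (R - K) h s)"
    by (simp add: weight_def K_def IH[unfolded K_def])
  \<comment> \<open>A nonempty \<open>R\<close> has a nonempty \<open>K\<close>, so summing over
    \<open>K\<close> undoes the division; for empty \<open>R\<close> both sides are 0.\<close>
  also have "weight I R i r = (\<Sum>s\<in>K. weight I R i r / card K)"
  proof (cases "R = {}")
    case True
    then show ?thesis using K by (simp add: weight_def covered_def)
  next
    case False
    then have "K \<noteq> {}" using 2 by (simp add: greedy_choice_def K_def)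
    then show ?thesis using K by simp
  qed
  also have "\<dots> + (\<Sum>s\<in>R - K. price I (R - K) h s) = (\<Sum>s\<in>R. price I R ((i, r) # h) s)"
    unfolding split using cov K
    by (intro arg_cong2[where f="(+)"] sum.cong) (auto simp flip: K_def)
  finally show ?case .
qed

text \<open>Consider the first pair of price above \<open>x\<close> chosen while scenarios are left.
  Those covered before have price at most \<open>x\<close>, so all scenarios of price above
  \<open>x\<close> lie in the current \<open>R\<close>, and by \<open>half\<close> at least half of
  this \<open>R\<close> has \<open>b\<close> above \<open>x\<close>. The set \<open>U\<close> stays
  fixed while \<open>R\<close> shrinks, which keeps \<open>half\<close> applicable in the
  induction.\<close>

lemma card_price_superlevel:
  fixes b :: "nat \<Rightarrow> real"
  assumes "greedy I R h" "finite R" "0 \<le> x" "R \<subseteq> U"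
    and half: "\<And>R i r. R \<subseteq> U \<Longrightarrow> R \<noteq> {} \<Longrightarrow> greedy_choice I R i r \<Longrightarrow>
      card R \<le> 2 * card {s\<in>R. weight I R i r / card (covered I R i r) \<le> b s}"
  shows "card {s\<in>R. x < price I R h s} \<le> 2 * card {s\<in>R. x < b s}"
  using assms
proof (induction I R h rule: greedy.induct)
  case (1 I R)
  then show ?case by simp
next
  case (2 I R i r h)
  note half = "2.prems"(5)
  have IH: "card {s\<in>R - covered I R i r. x < price I (R - covered I R i r) h s}
      \<le> 2 * card {s\<in>R - covered I R i r. x < b s}"
    by (rule "2.IH") (use "2.prems" in auto)
  define K where "K = covered I R i r"
  define y where "y = weight I R i r / card K"
  have KR: "K \<subseteq> R" by (simp add: K_def covered_subset)
  have cov: "s \<in> K \<longleftrightarrow> cost I i s \<le> cost I i r" if "s \<in> R" for s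
    using that by (auto simp: K_def covered_def)
  have price: "price I R ((i, r) # h) s = (if s \<in> K then y else price I (R - K) h s)"
    if "s \<in> R" for s
    using cov[OF that] by (simp add: y_def flip: K_def)
  show ?case
  proof (cases "x < y \<and> R \<noteq> {}")
    case True
    have "card {s\<in>R. x < price I R ((i, r) # h) s} \<le> card R"
      using "2.prems" by (intro card_mono) auto
    also have "\<dots> \<le> 2 * card {s\<in>R. y \<le> b s}"
      using half[of R i r] "2.prems" True by (simp add: y_def K_def)
    also have "card {s\<in>R. y \<le> b s} \<le> card {s\<in>R. x < b s}"
      using "2.prems" True by (intro card_mono) auto
    finally show ?thesis by simp
  next
    case False
    have "{s\<in>R. x < price I R ((i, r) # h) s} = {s\<in>R - K. x < price I (R - K) h s}"
      using False KR by (auto simp: price simp del: price.simps split: if_splits)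
    also have "card \<dots> \<le> 2 * card {s\<in>R - K. x < b s}"
      using IH by (simp add: K_def)
    also have "card {s\<in>R - K. x < b s} \<le> card {s\<in>R. x < b s}"
      using "2.prems" by (intro card_mono) auto
    finally show ?thesis by simp
  qed
qed

lemma price_nonneg:
  assumes "\<And>i s. s \<in> R \<Longrightarrow> i \<in> fst ` set h \<Longrightarrow> 0 \<le> cost I i s"
  shows "0 \<le> price I R h s"
  using assms
  by (induction I R h s rule: price.induct)
    (auto simp: weight_def covered_def intro!: divide_nonneg_nonneg add_nonneg_nonneg sum_nonneg)

section \<open>Comparison with an arbitrary strategy\<close>

lemma cost_nonneg:
  assumes "valid_instance I" "i < boxes I" "s < num_scens I"
  shows "0 \<le> cost I i s"
  using assms unfolding valid_instance_def cost_def by (metis nth_mem)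

text \<open>Only the scenarios in \<open>B\<close>, those of cost below \<open>y\<close> in box
  \<open>j\<close>, save anything. With the costliest of them as threshold, box \<open>j\<close>
  covers exactly \<open>B\<close>, so the minimality of \<open>y\<close> bounds
  \<open>y * card B\<close> by the weight of that pair, which is the claim rearranged.\<close>

lemma greedy_choice_capacity:
  assumes gr: "greedy_choice I R i r" and R: "R \<subseteq> {..<num_scens I}" "R \<noteq> {}" and j: "j < boxes I"
  defines "y \<equiv> weight I R i r / card (covered I R i r)"
  shows "(\<Sum>s\<in>R. max 0 (y - cost I j s)) \<le> card R"
proof -
  define B where "B = {s\<in>R. cost I j s < y}"
  have finR: "finite R" using R finite_subset by blast
  have finB: "finite B" using finR by (simp add: B_def)
  have sum: "(\<Sum>s\<in>R. max 0 (y - cost I j s)) = y * card B - (\<Sum>s\<in>B. cost I j s)"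
  proof -
    have "(\<Sum>s\<in>R. max 0 (y - cost I j s)) = (\<Sum>s\<in>B. max 0 (y - cost I j s))"
      using finR by (intro sum.mono_neutral_right) (auto simp: B_def)
    also have "\<dots> = (\<Sum>s\<in>B. y - cost I j s)"
      by (intro sum.cong) (auto simp: B_def)
    finally show ?thesis by (simp add: sum_subtractf mult.commute)
  qed
  show ?thesis
  proof (cases "B = {}")
    case True
    then show ?thesis by (simp add: sum)
  next
    case False
    have "Max (cost I j ` B) \<in> cost I j ` B" using finB False by (intro Max_in) auto
    then obtain q where "q \<in> B" "cost I j q = Max (cost I j ` B)" by auto
    then have q: "q \<in> B" "\<And>s. s \<in> B \<Longrightarrow> cost I j s \<le> cost I j q" using finB by auto
    have "covered I R j q = B" using q by (fastforce simp: covered_def B_def)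
    moreover have "covered I R i r \<noteq> {}" "finite (covered I R i r)"
      using gr R finR by (auto simp: greedy_choice_def covered_def)
    moreover have "q < num_scens I" using q R by (auto simp: B_def)
    ultimately have "y * card B \<le> weight I R j q"
      using gr R j by (auto simp: greedy_choice_def y_def field_simps card_gt_0_iff)
    also have "\<dots> = card R + (\<Sum>s\<in>B. cost I j s)"
      using \<open>covered I R j q = B\<close> by (simp add: weight_def)
    finally show ?thesis by (simp add: sum)
  qed
qed

lemma num_probes_bounds:
  assumes "boxes I \<ge> 1"
  shows "1 \<le> num_probes I \<sigma> s" "num_probes I \<sigma> s \<le> boxes I"
    "num_probes I \<sigma> s < boxes I \<Longrightarrow>
       stop \<sigma> (observed I (probe_order \<sigma>) s (num_probes I \<sigma> s))"
proof -
  define P where "P t \<longleftrightarrow> t \<ge> 1 \<and> (stop \<sigma> (observed I (probe_order \<sigma>) s t) \<or> t \<ge> boxes I)" for t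
  have "P (boxes I)" using assms by (simp add: P_def)
  moreover have "num_probes I \<sigma> s = (LEAST t. P t)" by (simp add: num_probes_def P_def)
  ultimately have "P (num_probes I \<sigma> s)" "num_probes I \<sigma> s \<le> boxes I"
    by (auto intro: LeastI Least_le)
  then show "1 \<le> num_probes I \<sigma> s" "num_probes I \<sigma> s \<le> boxes I"
    "num_probes I \<sigma> s < boxes I \<Longrightarrow>
       stop \<sigma> (observed I (probe_order \<sigma>) s (num_probes I \<sigma> s))"
    by (auto simp: P_def)
qed

lemma length_probe_order: "valid_strategy I \<sigma> \<Longrightarrow> length (probe_order \<sigma>) = boxes I"
  using distinct_card[of "probe_order \<sigma>"] by (simp add: valid_strategy_def)

lemma total_cost_decomp:
  assumes "boxes I \<ge> 1" "valid_strategy I \<sigma>"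
  obtains j where "j \<in> set (take (num_probes I \<sigma> s) (probe_order \<sigma>))"
    "total_cost I \<sigma> s = num_probes I \<sigma> s + cost I j s"
proof -
  let ?O = "set (observed I (probe_order \<sigma>) s (num_probes I \<sigma> s))"
  have "?O \<noteq> {}"
    using num_probes_bounds(1)[OF assms(1), of \<sigma> s] length_probe_order[OF assms(2)] assms(1)
    by (auto simp: observed_def)
  then have "Min ?O \<in> ?O" by (intro Min_in) auto
  then show ?thesis using that by (auto simp: observed_def total_cost_def)
qed

lemma total_cost_nonneg:
  assumes "valid_instance I" "valid_strategy I \<sigma>" "s < num_scens I"
  shows "0 \<le> total_cost I \<sigma> s"
proof -
  have "boxes I \<ge> 1" using assms by (simp add: valid_instance_def)
  then obtain j where j: "j \<in> set (take (num_probes I \<sigma> s) (probe_order \<sigma>))"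
    "total_cost I \<sigma> s = num_probes I \<sigma> s + cost I j s"
    using total_cost_decomp assms by metis
  have "j < boxes I" using j assms by (auto simp: valid_strategy_def dest: in_set_takeD)
  then show ?thesis using j cost_nonneg assms by simp
qed

text \<open>The scenarios that the strategy serves at total cost less than a third of the price y are served
  within the first y/3 boxes, each by a box of cost less than y/3. They therefore save more than
  2y/3 each with respect to y, while all boxes probed until then save at most one unit per box and
  remaining scenario.\<close>

lemma card_total_cost_ge:
  assumes I: "valid_instance I" and \<sigma>: "valid_strategy I \<sigma>"
    and R: "R \<subseteq> {..<num_scens I}" "R \<noteq> {}" and gr: "greedy_choice I R i r"
  defines "y \<equiv> weight I R i r / card (covered I R i r)"
  shows "card R \<le> 2 * card {s\<in>R. y \<le> 3 * total_cost I \<sigma> s}"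
proof -
  define K where "K = {s\<in>R. 3 * total_cost I \<sigma> s < y}"
  have finR: "finite R" using R finite_subset by blast
  have finK: "finite K" using finR by (simp add: K_def)
  have n: "boxes I \<ge> 1" using I by (simp add: valid_instance_def)
  have "2 * card K \<le> card R"
  proof (cases "K = {}")
    case False
    \<comment> \<open>Partial adaptivity enters here: the probing order is the same in all
      scenarios, so one set \<open>B\<close> of at most \<open>k\<close> boxes serves the whole of
      \<open>K\<close>.\<close>
    define k where "k = Max (num_probes I \<sigma> ` K)"
    define B where "B = set (take k (probe_order \<sigma>))"
    have B: "finite B" "B \<subseteq> {..<boxes I}" "card B \<le> k"
    proof -
      show "finite B" by (simp add: B_def)
      show "B \<subseteq> {..<boxes I}"
        using \<sigma> set_take_subset[of k "probe_order \<sigma>"] by (simp add: B_def valid_strategy_def)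
      have "card B \<le> length (take k (probe_order \<sigma>))" unfolding B_def by (rule card_length)
      then show "card B \<le> k" by simp
    qed
    have serve: "\<exists>j\<in>B. 2 * y \<le> 3 * (y - cost I j s)" if s: "s \<in> K" for s
    proof -
      obtain j where j: "j \<in> set (take (num_probes I \<sigma> s) (probe_order \<sigma>))"
        "total_cost I \<sigma> s = num_probes I \<sigma> s + cost I j s"
        using n \<sigma> by (rule total_cost_decomp)
      have "num_probes I \<sigma> s \<le> k" using s finK by (simp add: k_def)
      then have "j \<in> B" using subsetD[OF set_take_subset_set_take j(1)] by (simp add: B_def)
      moreover have "3 * cost I j s \<le> y" using s j by (simp add: K_def)
      ultimately show ?thesis by (intro bexI[of _ j]) auto
    qed
    have k: "3 * real k < y"
    proof -
      have "k \<in> num_probes I \<sigma> ` K" unfolding k_def using finK False by (intro Max_in) auto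
      then obtain s where s: "s \<in> K" "k = num_probes I \<sigma> s" by auto
      obtain j where j: "j \<in> set (take (num_probes I \<sigma> s) (probe_order \<sigma>))"
        "total_cost I \<sigma> s = num_probes I \<sigma> s + cost I j s"
        using n \<sigma> by (rule total_cost_decomp)
      have "0 \<le> cost I j s"
        using in_set_takeD[OF j(1)] \<sigma> s R by (intro cost_nonneg[OF I]) (auto simp: valid_strategy_def K_def)
      then show ?thesis using s j by (simp add: K_def)
    qed
    have y: "0 < y" using k by (rule le_less_trans[rotated]) simp
    have "2 * y * card K = (\<Sum>s\<in>K. 2 * y)" by simp
    also have "\<dots> \<le> (\<Sum>s\<in>K. \<Sum>j\<in>B. 3 * max 0 (y - cost I j s))"
    proof (intro sum_mono)
      fix s assume "s \<in> K"
      then obtain j where j: "j \<in> B" "2 * y \<le> 3 * (y - cost I j s)" using serve by blast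
      then have "2 * y \<le> 3 * max 0 (y - cost I j s)" by (smt (verit))
      also have "\<dots> \<le> (\<Sum>j\<in>B. 3 * max 0 (y - cost I j s))"
        using B j by (intro member_le_sum) auto
      finally show "2 * y \<le> (\<Sum>j\<in>B. 3 * max 0 (y - cost I j s))" .
    qed
    also have "\<dots> \<le> (\<Sum>s\<in>R. \<Sum>j\<in>B. 3 * max 0 (y - cost I j s))"
      using finR by (intro sum_mono2) (auto simp: K_def intro!: sum_nonneg)
    \<comment> \<open>With the sums exchanged, \<open>greedy_choice_capacity\<close> bounds the
      savings box by box.\<close>
    also have "\<dots> = 3 * (\<Sum>j\<in>B. \<Sum>s\<in>R. max 0 (y - cost I j s))"
      by (subst sum.swap) (simp add: sum_distrib_left)
    also have "\<dots> \<le> 3 * (\<Sum>j\<in>B. real (card R))"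
      unfolding y_def using greedy_choice_capacity[OF gr R] B
      by (intro mult_left_mono sum_mono) auto
    also have "\<dots> \<le> 3 * real k * card R" using B by (auto intro: mult_right_mono)
    also have "\<dots> \<le> y * card R" using k by (intro mult_right_mono) auto
    finally have "y * (2 * real (card K)) \<le> y * real (card R)" by (simp add: mult_ac)
    then show ?thesis using y by simp
  qed simp
  moreover have "card R = card K + card {s\<in>R. y \<le> 3 * total_cost I \<sigma> s}"
    using finR unfolding K_def by (subst card_Un_disjoint[symmetric]) (auto intro!: arg_cong[where f=card])
  ultimately show ?thesis by simp
qed

lemma sum_paid_le:
  assumes I: "valid_instance I" and \<sigma>: "valid_strategy I \<sigma>"
    and h: "greedy I {..<num_scens I} h" "remaining I {..<num_scens I} h = {}"
      "fst ` set h \<subseteq> {..<boxes I}"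
  shows "(\<Sum>s<num_scens I. paid I h s) \<le> 6 * (\<Sum>s<num_scens I. total_cost I \<sigma> s)"
proof -
  let ?R = "{..<num_scens I}"
  have "(\<Sum>s\<in>?R. paid I h s) = (\<Sum>s\<in>?R. price I ?R h s)"
    using h by (intro sum_paid_eq_sum_price) auto
  also have "\<dots> \<le> 2 * (\<Sum>s\<in>?R. 3 * total_cost I \<sigma> s)"
  proof (rule sum_le_of_card_superlevel)
    show "0 \<le> price I ?R h s" for s
      using h by (intro price_nonneg) (auto intro!: cost_nonneg[OF I])
    \<comment> \<open>With \<open>b\<close> three times the cost of \<open>\<sigma>\<close>, the
      assumption \<open>half\<close> of \<open>card_price_superlevel\<close> is exactly
      \<open>card_total_cost_ge\<close>.\<close>
    show "real (card {s\<in>?R. x < price I ?R h s}) \<le> 2 * real (card {s\<in>?R. x < 3 * total_cost I \<sigma> s})"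
      if "0 \<le> x" for x
      using card_price_superlevel[OF h(1) _ that, where b="\<lambda>s. 3 * total_cost I \<sigma> s" and U="?R"]
        card_total_cost_ge[OF I \<sigma>] by fastforce
  qed (auto simp: total_cost_nonneg[OF I \<sigma>])
  finally show ?thesis by (simp flip: sum_distrib_left)
qed

section \<open>Timed Hoare logic\<close>

text \<open>The program below contains no \<open>Flip\<close>, so its runs are chains of steps with
  a one-point distribution. Excluding \<open>Skip\<close>, which steps to itself, makes it terminal;
  \<open>dstep_Seq\<close> relies on this because \<open>Seq Skip d\<close> continues with
  \<open>d\<close>.\<close>

inductive dstep :: "search_instance \<Rightarrow> config \<Rightarrow> config \<Rightarrow> bool" for I where
  "c \<noteq> Skip \<Longrightarrow> step I c st = return_pmf cfg \<Longrightarrow> dstep I (c, st) cfg"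

lemma run_dstep:
  assumes "(dstep I ^^ k) (c, init_state) cfg"
  shows "run I c k = return_pmf cfg"
  using assms
proof (induction k arbitrary: cfg)
  case (Suc k)
  then show ?case by (auto elim!: relpowp_Suc_E dstep.cases simp: bind_return_pmf)
qed auto

text \<open>A halted program idles at \<open>Skip\<close>, so an upper bound on the running time
  suffices to know the run at a prescribed time.\<close>

lemma run_Skip:
  assumes "run I c k = return_pmf (Skip, st)" "k \<le> m"
  shows "run I c m = return_pmf (Skip, st)"
  using assms(2,1) by (induction m rule: dec_induct) (auto simp: bind_return_pmf)

lemma dstep_Seq:
  assumes "(dstep I ^^ k) (c, st) (c', st')"
  shows "(dstep I ^^ k) (Seq c d, st) (Seq c' d, st')"
  using assms
proof (induction k arbitrary: c' st')
  case (Suc k)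
  then obtain c1 st1 where 1: "(dstep I ^^ k) (c, st) (c1, st1)" "dstep I (c1, st1) (c', st')"
    by (metis relpowp_Suc_E surj_pair)
  have "dstep I (Seq c1 d, st1) (Seq c' d, st')"
    using 1(2) by (auto elim!: dstep.cases intro!: dstep.intros)
  then show ?case using Suc.IH[OF 1(1)] by (auto intro: relpowp_Suc_I)
qed auto

text \<open>Total correctness within \<open>k\<close> steps. Asking for some halting chain is
  enough, since by \<open>run_dstep\<close> a chain from the initial state determines the
  run.\<close>

definition hoare :: "search_instance \<Rightarrow> (state \<Rightarrow> bool) \<Rightarrow> com \<Rightarrow> nat \<Rightarrow> (state \<Rightarrow> bool) \<Rightarrow> bool" where
  "hoare I P c k Q \<longleftrightarrow>
     (\<forall>st. P st \<longrightarrow> (\<exists>m\<le>k. \<exists>st'. (dstep I ^^ m) (c, st) (Skip, st') \<and> Q st'))"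

lemma hoare_conseq:
  assumes "hoare I P c k Q" "\<And>st. P' st \<Longrightarrow> P st" "\<And>st. Q st \<Longrightarrow> Q' st" "k \<le> k'"
  shows "hoare I P' c k' Q'"
  using assms unfolding hoare_def by (meson order_trans)

lemma hoareE:
  assumes "hoare I P c k Q" "P st"
  obtains m st' where "m \<le> k" "(dstep I ^^ m) (c, st) (Skip, st')" "Q st'"
  using assms unfolding hoare_def by blast

lemma hoare_Skip: "(\<And>st. P st \<Longrightarrow> Q st) \<Longrightarrow> hoare I P Skip 0 Q"
  unfolding hoare_def by auto

lemma hoare_step:
  assumes "\<And>st. P st \<Longrightarrow> \<exists>st'. step I c st = return_pmf (Skip, st') \<and> Q st'" "c \<noteq> Skip"
  shows "hoare I P c 1 Q"
  unfolding hoare_def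
proof (intro allI impI)
  fix st assume "P st"
  then obtain st' where "step I c st = return_pmf (Skip, st')" "Q st'" using assms by blast
  then show "\<exists>m\<le>1. \<exists>st'. (dstep I ^^ m) (c, st) (Skip, st') \<and> Q st'"
    using assms(2) by (intro exI[of _ 1]) (auto intro!: dstep.intros)
qed

lemma hoare_NAssign:
  "(\<And>st. P st \<Longrightarrow> Q (set_nat x (nval I st a) (nval I st e) st)) \<Longrightarrow> hoare I P (NAssign x a e) 1 Q"
  by (rule hoare_step) auto

lemma hoare_RAssign:
  "(\<And>st. P st \<Longrightarrow> Q (set_real x (nval I st a) (rval I st e) st)) \<Longrightarrow> hoare I P (RAssign x a e) 1 Q"
  by (rule hoare_step) auto

lemma hoare_Seq:
  assumes "hoare I P c k1 M" "hoare I M d k2 Q"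
  shows "hoare I P (Seq c d) (k1 + k2 + 1) Q"
  unfolding hoare_def
proof (intro allI impI)
  fix st assume "P st"
  then obtain m1 st1 where 1: "m1 \<le> k1" "(dstep I ^^ m1) (c, st) (Skip, st1)" "M st1"
    using assms(1) by (elim hoareE)
  obtain m2 st2 where 2: "m2 \<le> k2" "(dstep I ^^ m2) (d, st1) (Skip, st2)" "Q st2"
    using assms(2) 1(3) by (elim hoareE)
  have "dstep I (Seq Skip d, st1) (d, st1)" by (auto intro!: dstep.intros)
  then have "(dstep I ^^ Suc m1) (Seq c d, st) (d, st1)"
    using dstep_Seq[OF 1(2)] by (auto intro: relpowp_Suc_I)
  then have "(dstep I ^^ (Suc m1 + m2)) (Seq c d, st) (Skip, st2)"
    using 2(2) unfolding relpowp_add by blast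
  then show "\<exists>m\<le>k1 + k2 + 1. \<exists>st'. (dstep I ^^ m) (Seq c d, st) (Skip, st') \<and> Q st'"
    using 1 2 by (intro exI[of _ "Suc m1 + m2"]) auto
qed

text \<open>Common core of the rules for conditionals and loops: the first step keeps the state and
  only selects the next command, possibly depending on the state.\<close>

lemma hoare_Suc:
  assumes "\<And>st. P st \<Longrightarrow> dstep I (c, st) (d st, st) \<and> hoare I (\<lambda>st'. st' = st) (d st) k Q"
  shows "hoare I P c (Suc k) Q"
  unfolding hoare_def
proof (intro allI impI)
  fix st assume "P st"
  then obtain m st' where "m \<le> k" "(dstep I ^^ m) (d st, st) (Skip, st')" "Q st'"
    using assms[of st] by (auto elim: hoareE)
  moreover have "dstep I (c, st) (d st, st)" using assms \<open>P st\<close> by blast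
  ultimately show "\<exists>m\<le>Suc k. \<exists>st'. (dstep I ^^ m) (c, st) (Skip, st') \<and> Q st'"
    by (intro exI[of _ "Suc m"]) (auto intro: relpowp_Suc_I2 simp del: relpowp.simps)
qed

lemma hoare_Cond:
  assumes "hoare I (\<lambda>st. P st \<and> bval I st b) c k Q" "hoare I (\<lambda>st. P st \<and> \<not> bval I st b) d k Q"
  shows "hoare I P (Cond b c d) (Suc k) Q"
proof (rule hoare_Suc[where d="\<lambda>st. if bval I st b then c else d"], intro conjI)
  fix st assume "P st"
  then show "hoare I (\<lambda>st'. st' = st) (if bval I st b then c else d) k Q"
    using assms by (auto elim!: hoare_conseq)
qed (auto intro!: dstep.intros)

section \<open>Counting loops\<close>

definition For :: "vname \<Rightarrow> nexp \<Rightarrow> com \<Rightarrow> com" where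
  "For x e c = Seq (NAssign x (Const 0) (Const 0)) (While (NLess (NGet x (Const 0)) e)
     (Seq c (NAssign x (Const 0) (NPlus (NGet x (Const 0)) (Const 1)))))"

text \<open>The iteration number is a parameter of \<open>Inv\<close>, which has to survive any
  change of the counter cell. A round adds 5 steps to its body: unfolding, test, increment and two
  sequencing steps. The initialisation, its sequencing step, the last unfolding and the failing test
  make up the final 4.\<close>

lemma hoare_For:
  assumes body: "\<And>j. j < N \<Longrightarrow> hoare I (\<lambda>st. Inv j st \<and> nats st x 0 = j) c k
                  (\<lambda>st. Inv (Suc j) st \<and> nats st x 0 = j)"
    and x: "\<And>j v st. Inv j st \<Longrightarrow> Inv j (set_nat x 0 v st)"
    and N: "\<And>st. nval I st e = N"
  shows "hoare I (Inv 0) (For x e c) (N * (k + 5) + 4) (Inv N)"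
proof -
  let ?b = "NLess (NGet x (Const 0)) e"
  let ?c = "Seq c (NAssign x (Const 0) (NPlus (NGet x (Const 0)) (Const 1)))"
  have while_step: "dstep I (While b c, st) (Cond b (Seq c (While b c)) Skip, st)" for b c st
    by (auto intro!: dstep.intros)
  have loop: "hoare I (\<lambda>st. Inv j st \<and> nats st x 0 = j) (While ?b ?c) ((N - j) * (k + 5) + 2) (Inv N)"
    if "j \<le> N" for j
    using that
  proof (induction "N - j" arbitrary: j)
    case 0
    have "hoare I (\<lambda>st. Inv j st \<and> nats st x 0 = j) (While ?b ?c) (Suc (Suc 0)) (Inv N)"
    proof (rule hoare_Suc, rule conjI, rule while_step)
      fix st assume "Inv j st \<and> nats st x 0 = j"
      then show "hoare I (\<lambda>st'. st' = st) (Cond ?b (Seq ?c (While ?b ?c)) Skip) (Suc 0) (Inv N)"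
        using 0 by (intro hoare_Cond) (auto simp: hoare_def N)
    qed
    then show ?case using 0 by (auto simp: numeral_2_eq_2)
  next
    case (Suc d)
    then have j: "j < N" by simp
    have c: "hoare I (\<lambda>st. Inv j st \<and> nats st x 0 = j) ?c (k + 1 + 1)
        (\<lambda>st. Inv (Suc j) st \<and> nats st x 0 = Suc j)"
      by (rule hoare_Seq[OF body[OF j]], rule hoare_NAssign) (auto simp: x, simp add: set_nat_def)
    have "hoare I (\<lambda>st. Inv j st \<and> nats st x 0 = j) (While ?b ?c)
        (Suc (Suc (k + 1 + 1 + ((N - Suc j) * (k + 5) + 2) + 1))) (Inv N)"
    proof (rule hoare_Suc, rule conjI, rule while_step)
      fix st assume st: "Inv j st \<and> nats st x 0 = j"
      have "hoare I (\<lambda>st'. st' = st) (Seq ?c (While ?b ?c)) (k + 1 + 1 + ((N - Suc j) * (k + 5) + 2) + 1) (Inv N)"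
      proof (rule hoare_Seq)
        show "hoare I (\<lambda>st'. st' = st) ?c (k + 1 + 1) (\<lambda>st. Inv (Suc j) st \<and> nats st x 0 = Suc j)"
          using c st by (auto elim: hoare_conseq)
      qed (use Suc j in auto)
      then show "hoare I (\<lambda>st'. st' = st) (Cond ?b (Seq ?c (While ?b ?c)) Skip)
          (Suc (k + 1 + 1 + ((N - Suc j) * (k + 5) + 2) + 1)) (Inv N)"
        using st j by (intro hoare_Cond) (auto simp: hoare_def N)
    qed
    moreover have "N - j = Suc (N - Suc j)" using j by simp
    ultimately show ?case by (auto elim!: hoare_conseq simp: algebra_simps)
  qed
  have "hoare I (Inv 0) (For x e c) (1 + ((N - 0) * (k + 5) + 2) + 1) (Inv N)"
    unfolding For_def
    by (rule hoare_Seq[OF _ loop], rule hoare_NAssign) (auto simp: x, simp add: set_nat_def)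
  then show ?thesis by (rule hoare_conseq) auto
qed

section \<open>Symbolic evaluation of loop-free code\<close>

primrec loop_free :: "com \<Rightarrow> bool" where
  "loop_free Skip \<longleftrightarrow> True"
| "loop_free (NAssign x a e) \<longleftrightarrow> True"
| "loop_free (RAssign x a e) \<longleftrightarrow> True"
| "loop_free (Flip x a r) \<longleftrightarrow> False"
| "loop_free (Seq c d) \<longleftrightarrow> loop_free c \<and> loop_free d"
| "loop_free (Cond b c d) \<longleftrightarrow> loop_free c \<and> loop_free d"
| "loop_free (While b c) \<longleftrightarrow> False"

primrec exec :: "search_instance \<Rightarrow> com \<Rightarrow> state \<Rightarrow> state" where
  "exec I Skip st = st"
| "exec I (NAssign x a e) st = set_nat x (nval I st a) (nval I st e) st"
| "exec I (RAssign x a e) st = set_real x (nval I st a) (rval I st e) st"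
| "exec I (Flip x a r) st = undefined"
| "exec I (Seq c d) st = exec I d (exec I c st)"
| "exec I (Cond b c d) st = (if bval I st b then exec I c st else exec I d st)"
| "exec I (While b c) st = undefined"

primrec time_bound :: "com \<Rightarrow> nat" where
  "time_bound Skip = 0"
| "time_bound (NAssign x a e) = 1"
| "time_bound (RAssign x a e) = 1"
| "time_bound (Flip x a r) = 1"
| "time_bound (Seq c d) = time_bound c + time_bound d + 1"
| "time_bound (Cond b c d) = Suc (time_bound c + time_bound d)"
| "time_bound (While b c) = undefined"

text \<open>Reduces a triple for loop-free code to evaluating \<open>exec\<close> by simplification.
  A conditional is charged for both of its branches, so the bound is a constant fixed by the code.
  The clauses with value \<open>undefined\<close> are excluded by \<open>loop_free\<close>.\<close>

lemma hoare_exec: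
  assumes "loop_free c" "\<And>st. P st \<Longrightarrow> Q (exec I c st)" "time_bound c \<le> k"
  shows "hoare I P c k Q"
proof -
  have "hoare I P c (time_bound c) Q"
    using assms(1,2)
  proof (induction c arbitrary: P Q)
    case Skip
    then show ?case by (simp add: hoare_Skip)
  next
    case (NAssign x a e)
    then show ?case unfolding time_bound.simps by (intro hoare_NAssign) simp
  next
    case (RAssign x a e)
    then show ?case unfolding time_bound.simps by (intro hoare_RAssign) simp
  next
    case (Seq c d)
    have "hoare I P c (time_bound c) (\<lambda>st. Q (exec I d st))" using Seq by simp
    moreover have "hoare I (\<lambda>st. Q (exec I d st)) d (time_bound d) Q" using Seq by simp
    ultimately show ?case unfolding time_bound.simps by (rule hoare_Seq)
  next
    case (Cond b c d)
    have c: "Q (exec I c st)" if "P st \<and> bval I st b" for st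
      using Cond.prems(2)[of st] that by simp
    have d: "Q (exec I d st)" if "P st \<and> \<not> bval I st b" for st
      using Cond.prems(2)[of st] that by simp
    have "hoare I (\<lambda>st. P st \<and> bval I st b) c (time_bound c) Q"
      using Cond.prems(1) c by (intro Cond.IH(1)) auto
    moreover have "hoare I (\<lambda>st. P st \<and> \<not> bval I st b) d (time_bound d) Q"
      using Cond.prems(1) d by (intro Cond.IH(2)) auto
    ultimately show ?case
      unfolding time_bound.simps by (intro hoare_Cond) (auto elim: hoare_conseq)
  qed auto
  then show ?thesis by (rule hoare_conseq) (use assms(3) in auto)
qed

text \<open>Fixes ghost values such as the history before a triple is proved.\<close>

lemma hoare_ex: "(\<And>h. hoare I (P h) c k Q) \<Longrightarrow> hoare I (\<lambda>st. \<exists>h. P h st) c k Q"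
  unfolding hoare_def by blast

lemma hoare_conj_const: "(A \<Longrightarrow> hoare I P c k Q) \<Longrightarrow> hoare I (\<lambda>st. A \<and> P st) c k Q"
  unfolding hoare_def by blast

lemma nats_set_nat [simp]:
  "nats (set_nat x a v st) y = (if y = x then (nats st x)(a := v) else nats st y)"
  by (simp add: set_nat_def)

lemma nats_set_real [simp]: "nats (set_real x a v st) = nats st"
  by (simp add: set_real_def)

lemma reals_set_nat [simp]: "reals (set_nat x a v st) = reals st"
  by (simp add: set_nat_def)

lemma reals_set_real [simp]:
  "reals (set_real x a v st) y = (if y = x then (reals st x)(a := v) else reals st y)"
  by (simp add: set_real_def)

section \<open>The program\<close>

abbreviation nvar :: "vname \<Rightarrow> nexp" where "nvar x \<equiv> NGet x (Const 0)"
abbreviation rvar :: "vname \<Rightarrow> rexp" where "rvar x \<equiv> RGet x (Const 0)"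

text \<open>Each uncovered scenario contributes the 1 that builds up \<open>card R\<close>, and its
  cost as well if it is within the threshold. The mark \<open>dead\<close> is 0 for uncovered
  scenarios, in line with the zero initialisation of arrays.\<close>

definition scan_scenario :: com where
  "scan_scenario =
     Cond (NLess (NGet ''dead'' (nvar ''s'')) (Const 1))
       (Seq (RAssign ''sum'' (Const 0) (RPlus (rvar ''sum'') (OfNat (Const 1))))
         (Cond (BNot (RLess (Cost (nvar ''i'') (nvar ''r'')) (Cost (nvar ''i'') (nvar ''s''))))
           (Seq (RAssign ''sum'' (Const 0) (RPlus (rvar ''sum'') (Cost (nvar ''i'') (nvar ''s''))))
             (NAssign ''cnt'' (Const 0) (NPlus (nvar ''cnt'') (Const 1))))
           Skip))
       Skip"

definition scan :: com where
  "scan = Seq (Seq (RAssign ''sum'' (Const 0) (OfNat (Const 0))) (NAssign ''cnt'' (Const 0) (Const 0)))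
     (For ''s'' NumScens scan_scenario)"

text \<open>The best pair so far has weight bsum and covers bcnt scenarios; the initial values 1 and 0
  stand for an infinite ratio.\<close>

definition update_best :: com where
  "update_best =
     Cond (RLess (RTimes (rvar ''sum'') (OfNat (nvar ''bcnt''))) (RTimes (rvar ''bsum'') (OfNat (nvar ''cnt''))))
       (Seq (Seq (RAssign ''bsum'' (Const 0) (rvar ''sum'')) (NAssign ''bcnt'' (Const 0) (nvar ''cnt'')))
         (Seq (NAssign ''bi'' (Const 0) (nvar ''i'')) (NAssign ''br'' (Const 0) (nvar ''r''))))
       Skip"

definition init_best :: com where
  "init_best =
     Seq (Seq (RAssign ''bsum'' (Const 0) (OfNat (Const 1))) (NAssign ''bcnt'' (Const 0) (Const 0)))
       (Seq (NAssign ''bi'' (Const 0) (Const 0)) (NAssign ''br'' (Const 0) (Const 0)))"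

definition search :: com where
  "search = Seq init_best (For ''i'' NumBoxes (For ''r'' NumScens (Seq scan update_best)))"

text \<open>A box chosen again is not appended, which keeps \<open>order\<close> free of
  repetitions. The same code finally completes \<open>order\<close> to a permutation of all
  boxes.\<close>

definition append_box :: "vname \<Rightarrow> com" where
  "append_box x =
     Cond (NLess (NGet ''used'' (nvar x)) (Const 1))
       (Seq (NAssign ''used'' (nvar x) (Const 1))
         (Seq (NAssign ''order'' (nvar ''pos'') (nvar x))
           (NAssign ''pos'' (Const 0) (NPlus (nvar ''pos'') (Const 1)))))
       Skip"

text \<open>This runs after \<open>append_box\<close>, so \<open>pos\<close> already counts the box
  just chosen.\<close>

definition retire_scenario :: com where
  "retire_scenario =
     Cond (BAnd (NLess (NGet ''dead'' (nvar ''s'')) (Const 1))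
         (BNot (RLess (Cost (nvar ''bi'') (nvar ''br'')) (Cost (nvar ''bi'') (nvar ''s'')))))
       (Seq (NAssign ''dead'' (nvar ''s'') (Const 1)) (NAssign ''stop'' (nvar ''s'') (nvar ''pos'')))
       Skip"

text \<open>As many rounds as scenarios suffice, because each round covers a scenario as long as one
  is left. A surplus round falls back on box 0 and retires nothing.\<close>

definition greedy_program :: com where
  "greedy_program =
     Seq (For ''t'' NumScens
         (Seq search (Seq (append_box ''bi'') (For ''s'' NumScens retire_scenario))))
       (For ''i'' NumBoxes (append_box ''i''))"

section \<open>Correctness of the search for the best pair\<close>

lemma hoare_scan:
  assumes frame: "\<And>x v st. x \<in> {''s'', ''cnt''} \<Longrightarrow> F st \<Longrightarrow> F (set_nat x 0 v st)"
    "\<And>v st. F st \<Longrightarrow> F (set_real ''sum'' 0 v st)"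
    and F: "\<And>st. F st \<Longrightarrow> (\<forall>s<num_scens I. nats st ''dead'' s = 0 \<longleftrightarrow> s \<in> R) \<and>
      nats st ''i'' 0 = i \<and> nats st ''r'' 0 = r"
    and i: "i < boxes I" and r: "r < num_scens I" and R: "R \<subseteq> {..<num_scens I}"
  shows "hoare I F scan (num_scens I * 20 + 10)
    (\<lambda>st. F st \<and> reals st ''sum'' 0 = weight I R i r \<and> nats st ''cnt'' 0 = card (covered I R i r))"
proof -
  \<comment> \<open>\<open>F\<close> stays abstract: any assertion of the caller that is independent
    of the variables written by the scan is carried through the loop. The totals range over the
    scenarios below \<open>j\<close>.\<close>
  define Inv where "Inv j st \<longleftrightarrow> F st \<and>
    reals st ''sum'' 0 = card (R \<inter> {..<j}) + (\<Sum>s\<in>covered I R i r \<inter> {..<j}. cost I i s) \<and>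
    nats st ''cnt'' 0 = card (covered I R i r \<inter> {..<j})" for j st
  have R': "R \<inter> {..<Suc j} = (if j \<in> R then insert j (R \<inter> {..<j}) else R \<inter> {..<j})" for j R
    by (auto simp: less_Suc_eq)
  have body: "hoare I (\<lambda>st. Inv j st \<and> nats st ''s'' 0 = j) scan_scenario 15
      (\<lambda>st. Inv (Suc j) st \<and> nats st ''s'' 0 = j)" if j: "j < num_scens I" for j
  proof (rule hoare_exec)
    fix st assume st: "Inv j st \<and> nats st ''s'' 0 = j"
    then have "F st" by (simp add: Inv_def)
    from F[OF this] have *: "nats st ''dead'' j = 0 \<longleftrightarrow> j \<in> R" "nats st ''i'' 0 = i" "nats st ''r'' 0 = r"
      using j by auto
    have cov: "j \<in> covered I R i r \<longleftrightarrow> j \<in> R \<and> cost I i j \<le> cost I i r" by (simp add: covered_def)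
    show "Inv (Suc j) (exec I scan_scenario st) \<and> nats (exec I scan_scenario st) ''s'' 0 = j"
      using st i r j by (auto simp: Inv_def scan_scenario_def * R' cov frame not_less)
  qed (simp_all add: scan_scenario_def)
  have loop: "hoare I (Inv 0) (For ''s'' NumScens scan_scenario) (num_scens I * (15 + 5) + 4) (Inv (num_scens I))"
    by (rule hoare_For[OF body]) (auto simp: Inv_def frame)
  have "hoare I F scan (3 + (num_scens I * (15 + 5) + 4) + 1) (Inv (num_scens I))"
    unfolding scan_def
    by (rule hoare_Seq[OF _ loop], rule hoare_exec) (auto simp: Inv_def frame)
  then show ?thesis
  proof (rule hoare_conseq)
    fix st assume "Inv (num_scens I) st"
    moreover have "R \<inter> {..<num_scens I} = R" "covered I R i r \<inter> {..<num_scens I} = covered I R i r"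
      using R by (auto simp: covered_def)
    ultimately show "F st \<and> reals st ''sum'' 0 = weight I R i r \<and> nats st ''cnt'' 0 = card (covered I R i r)"
      by (simp add: Inv_def weight_def)
  qed auto
qed

text \<open>\<open>Z\<close> holds the pairs tried so far. While \<open>bcnt\<close> is 0, the
  inequality with \<open>bsum\<close> equal to 1 says that no pair in \<open>Z\<close> covers
  anything.\<close>

definition best :: "search_instance \<Rightarrow> nat set \<Rightarrow> (nat \<times> nat) set \<Rightarrow> state \<Rightarrow> bool" where
  "best I R Z st \<longleftrightarrow>
     (\<forall>(j, q)\<in>Z. reals st ''bsum'' 0 * card (covered I R j q) \<le> weight I R j q * nats st ''bcnt'' 0) \<and>
     (if nats st ''bcnt'' 0 = 0
      then reals st ''bsum'' 0 = 1 \<and> nats st ''bi'' 0 = 0 \<and> nats st ''br'' 0 = 0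
      else nats st ''bi'' 0 < boxes I \<and> nats st ''br'' 0 < num_scens I \<and>
        reals st ''bsum'' 0 = weight I R (nats st ''bi'' 0) (nats st ''br'' 0) \<and>
        nats st ''bcnt'' 0 = card (covered I R (nats st ''bi'' 0) (nats st ''br'' 0)))"

lemma best_set_nat:
  assumes "x \<notin> {''bcnt'', ''bi'', ''br''}"
  shows "best I R Z (set_nat x a v st) = best I R Z st"
proof -
  have "nats (set_nat x a v st) y = nats st y" if "y \<in> {''bcnt'', ''bi'', ''br''}" for y
    using assms that by auto
  then show ?thesis by (simp add: best_def)
qed

lemma best_set_real: "x \<noteq> ''bsum'' \<Longrightarrow> best I R Z (set_real x a v st) = best I R Z st"
  by (simp add: best_def)

lemma weight_nonneg:
  assumes "valid_instance I" "R \<subseteq> {..<num_scens I}" "i < boxes I"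
  shows "0 \<le> weight I R i r"
  unfolding weight_def using assms cost_nonneg[OF assms(1,3)]
  by (intro add_nonneg_nonneg sum_nonneg) (auto simp: covered_def)

text \<open>A strict improvement forces the new pair to cover something. It beats the earlier pairs
  by transitivity through the old best, cancelling the positive \<open>bcnt\<close>; if
  \<open>bcnt\<close> is 0, the earlier pairs cover nothing and the comparison is trivial.\<close>

lemma best_update:
  assumes I: "valid_instance I" and R: "R \<subseteq> {..<num_scens I}"
    and Z: "Z \<subseteq> {..<boxes I} \<times> {..<num_scens I}" and b: "best I R Z st"
    and i: "nats st ''i'' 0 = i" "i < boxes I" and r: "nats st ''r'' 0 = r" "r < num_scens I"
    and sum: "reals st ''sum'' 0 = weight I R i r" and cnt: "nats st ''cnt'' 0 = card (covered I R i r)"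
  shows "best I R (insert (i, r) Z) (exec I update_best st)"
proof (cases "weight I R i r * nats st ''bcnt'' 0 < reals st ''bsum'' 0 * card (covered I R i r)")
  case False
  then show ?thesis using b sum cnt by (auto simp: best_def update_best_def not_less)
next
  case True
  let ?w = "weight I R i r" and ?c = "real (card (covered I R i r))"
  let ?bs = "reals st ''bsum'' 0" and ?bc = "real (nats st ''bcnt'' 0)"
  have w: "0 \<le> ?w" using weight_nonneg I R i by blast
  then have "0 \<le> ?w * ?bc" by simp
  then have "0 < ?bs * ?c" using True by linarith
  then have pos: "0 < card (covered I R i r)" by (metis gr0I less_irrefl mult_zero_right of_nat_0)
  have "?w * card (covered I R j q) \<le> weight I R j q * ?c" if jq: "(j, q) \<in> Z" for j q
  proof (cases "nats st ''bcnt'' 0 = 0")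
    case True
    then have "card (covered I R j q) = 0" using b jq by (force simp: best_def)
    then show ?thesis using weight_nonneg[OF I R] Z jq by auto
  next
    case False
    let ?d = "real (card (covered I R j q))"
    have "(?w * ?d) * ?bc = (?w * ?bc) * ?d" by simp
    also have "\<dots> \<le> (?bs * ?c) * ?d" using True by (intro mult_right_mono) auto
    also have "\<dots> = (?bs * ?d) * ?c" by simp
    also have "\<dots> \<le> (weight I R j q * ?bc) * ?c"
      using b jq by (intro mult_right_mono) (auto simp: best_def)
    finally have "(?w * ?d) * ?bc \<le> (weight I R j q * ?c) * ?bc" by (simp add: mult_ac)
    then show ?thesis using False by simp
  qed
  then show ?thesis
    using True sum cnt i r pos by (auto simp: best_def update_best_def)
qed

text \<open>If some \<open>r\<close> is uncovered, the pair of box 0 and \<open>r\<close> covers at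
  least \<open>r\<close>, so the search cannot end with \<open>bcnt\<close> equal to 0. For empty
  \<open>R\<close> the default pair of indices 0 is in range.\<close>

lemma best_greedy_choice:
  assumes "valid_instance I" "R \<subseteq> {..<num_scens I}" "best I R ({..<boxes I} \<times> {..<num_scens I}) st"
  shows "greedy_choice I R (nats st ''bi'' 0) (nats st ''br'' 0)" "nats st ''br'' 0 < num_scens I"
proof -
  have n: "0 < boxes I" "0 < num_scens I" using assms(1) by (auto simp: valid_instance_def)
  have "nats st ''bcnt'' 0 \<noteq> 0" if "R \<noteq> {}"
  proof
    assume 0: "nats st ''bcnt'' 0 = 0"
    obtain r where r: "r \<in> R" using \<open>R \<noteq> {}\<close> by auto
    then have "r < num_scens I" using assms by auto
    then have "card (covered I R 0 r) = 0" using 0 n assms(3) by (force simp: best_def)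
    moreover have "finite R" using assms(2) finite_subset by blast
    ultimately show False using r by (auto simp: covered_def)
  qed
  then show "greedy_choice I R (nats st ''bi'' 0) (nats st ''br'' 0)" "nats st ''br'' 0 < num_scens I"
    using assms(3) n unfolding best_def greedy_choice_def by (auto split: if_splits)
qed

lemma hoare_search:
  assumes I: "valid_instance I" and R: "R \<subseteq> {..<num_scens I}"
    and frame: "\<And>x v st. x \<in> {''s'', ''cnt'', ''i'', ''r'', ''bcnt'', ''bi'', ''br''} \<Longrightarrow> G st \<Longrightarrow> G (set_nat x 0 v st)"
    "\<And>x v st. x \<in> {''sum'', ''bsum''} \<Longrightarrow> G st \<Longrightarrow> G (set_real x 0 v st)"
    and G: "\<And>st. G st \<Longrightarrow> \<forall>s<num_scens I. nats st ''dead'' s = 0 \<longleftrightarrow> s \<in> R"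
  shows "hoare I G search (boxes I * (num_scens I * (num_scens I * 20 + 30) + 10) + 20)
    (\<lambda>st. G st \<and> greedy_choice I R (nats st ''bi'' 0) (nats st ''br'' 0) \<and> nats st ''br'' 0 < num_scens I)"
proof -
  let ?S = "num_scens I" and ?n = "boxes I"
  \<comment> \<open>Pairs are tried in lexicographic order: the complete rows below
    \<open>i\<close>, then the pairs of row \<open>i\<close> with threshold index below
    \<open>r\<close>.\<close>
  have body: "hoare I (\<lambda>st. (G st \<and> best I R ({..<i} \<times> {..<?S} \<union> {i} \<times> {..<r}) st \<and> nats st ''i'' 0 = i) \<and> nats st ''r'' 0 = r)
      (Seq scan update_best) (?S * 20 + 25)
      (\<lambda>st. (G st \<and> best I R ({..<i} \<times> {..<?S} \<union> {i} \<times> {..<Suc r}) st \<and> nats st ''i'' 0 = i) \<and> nats st ''r'' 0 = r)"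
    if i: "i < ?n" and r: "r < ?S" for i r
  proof -
    let ?Z = "{..<i} \<times> {..<?S} \<union> {i} \<times> {..<r}"
    have Z: "insert (i, r) ?Z = {..<i} \<times> {..<?S} \<union> {i} \<times> {..<Suc r}" by (auto simp: less_Suc_eq)
    have Zsub: "?Z \<subseteq> {..<?n} \<times> {..<?S}" using i r by auto
    let ?F = "\<lambda>st. (G st \<and> best I R ?Z st \<and> nats st ''i'' 0 = i) \<and> nats st ''r'' 0 = r"
    have "hoare I ?F scan (?S * 20 + 10)
      (\<lambda>st. ?F st \<and> reals st ''sum'' 0 = weight I R i r \<and> nats st ''cnt'' 0 = card (covered I R i r))"
      by (rule hoare_scan[OF _ _ _ i r R]) (auto simp: best_set_nat best_set_real frame G)
    then have "hoare I ?F (Seq scan update_best) (?S * 20 + 10 + 12 + 1)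
      (\<lambda>st. (G st \<and> best I R (insert (i, r) ?Z) st \<and> nats st ''i'' 0 = i) \<and> nats st ''r'' 0 = r)"
    proof (rule hoare_Seq, intro hoare_exec)
      fix st assume st: "?F st \<and> reals st ''sum'' 0 = weight I R i r \<and> nats st ''cnt'' 0 = card (covered I R i r)"
      then have "best I R (insert (i, r) ?Z) (exec I update_best st)"
        using i r by (intro best_update[OF I R Zsub]) auto
      moreover have "G (exec I update_best st)" "nats (exec I update_best st) ''i'' 0 = i"
        "nats (exec I update_best st) ''r'' 0 = r"
        using st by (auto simp: update_best_def frame)
      ultimately show "(G (exec I update_best st) \<and> best I R (insert (i, r) ?Z) (exec I update_best st) \<and>
          nats (exec I update_best st) ''i'' 0 = i) \<and> nats (exec I update_best st) ''r'' 0 = r"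
        by simp
    qed (simp_all add: update_best_def)
    then show ?thesis unfolding Z by (rule hoare_conseq) auto
  qed
  have row: "hoare I (\<lambda>st. (G st \<and> best I R ({..<i} \<times> {..<?S}) st) \<and> nats st ''i'' 0 = i)
      (For ''r'' NumScens (Seq scan update_best)) (?S * (?S * 20 + 25 + 5) + 4)
      (\<lambda>st. (G st \<and> best I R ({..<Suc i} \<times> {..<?S}) st) \<and> nats st ''i'' 0 = i)"
    if i: "i < ?n" for i
  proof -
    have Z: "{..<i} \<times> {..<?S} \<union> {i} \<times> {..<?S} = {..<Suc i} \<times> {..<?S}" by (auto simp: less_Suc_eq)
    have "hoare I (\<lambda>st. G st \<and> best I R ({..<i} \<times> {..<?S} \<union> {i} \<times> {..<0}) st \<and> nats st ''i'' 0 = i)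
      (For ''r'' NumScens (Seq scan update_best)) (?S * (?S * 20 + 25 + 5) + 4)
      (\<lambda>st. G st \<and> best I R ({..<i} \<times> {..<?S} \<union> {i} \<times> {..<?S}) st \<and> nats st ''i'' 0 = i)"
      by (rule hoare_For[OF body[OF i]]) (auto simp: best_set_nat best_set_real frame)
    then show ?thesis unfolding Z by (rule hoare_conseq) auto
  qed
  have loop: "hoare I (\<lambda>st. G st \<and> best I R ({..<0} \<times> {..<?S}) st)
      (For ''i'' NumBoxes (For ''r'' NumScens (Seq scan update_best)))
      (?n * (?S * (?S * 20 + 25 + 5) + 4 + 5) + 4) (\<lambda>st. G st \<and> best I R ({..<?n} \<times> {..<?S}) st)"
    by (rule hoare_For[OF row]) (auto simp: best_set_nat best_set_real frame)
  have init: "best I R {} (exec I init_best st)" for st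
    by (simp add: best_def init_best_def)
  have run: "hoare I G search (7 + (?n * (?S * (?S * 20 + 25 + 5) + 4 + 5) + 4) + 1)
      (\<lambda>st. G st \<and> best I R ({..<?n} \<times> {..<?S}) st)"
    unfolding search_def
    by (rule hoare_Seq[OF _ loop], rule hoare_exec) (use init in \<open>auto simp: init_best_def frame\<close>)
  have "?n * (?S * (?S * 20 + 25 + 5) + 4 + 5) \<le> ?n * (?S * (?S * 20 + 30) + 10)"
    by (intro mult_le_mono2) (simp add: algebra_simps)
  then have "7 + (?n * (?S * (?S * 20 + 25 + 5) + 4 + 5) + 4) + 1 \<le> ?n * (?S * (?S * 20 + 30) + 10) + 20"
    by linarith
  with run show ?thesis
    by (elim hoare_conseq) (auto simp: best_greedy_choice[OF I R])
qed

section \<open>Invariants of the main loop\<close>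

definition listing :: "nat set \<Rightarrow> state \<Rightarrow> bool" where
  "listing B st \<longleftrightarrow>
     distinct (map (nats st ''order'') [0..<nats st ''pos'' 0]) \<and>
     set (map (nats st ''order'') [0..<nats st ''pos'' 0]) = B \<and>
     (\<forall>i. nats st ''used'' i = 0 \<longleftrightarrow> i \<notin> B)"

text \<open>The history h records the pairs chosen so far; the scenario s was covered by the pair (i, r)
  after the pairs h1, and its stopping time counts the distinct boxes chosen until then.\<close>

definition stop_ok :: "search_instance \<Rightarrow> (nat \<times> nat) list \<Rightarrow> nat \<Rightarrow> state \<Rightarrow> bool" where
  "stop_ok I h s st \<longleftrightarrow> (\<exists>h1 i r h2. h = h1 @ (i, r) # h2 \<and>
     s \<in> remaining I {..<num_scens I} h1 \<and> cost I i s \<le> cost I i r \<and>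
     nats st ''stop'' s \<le> nats st ''pos'' 0 \<and>
     set (map (nats st ''order'') [0..<nats st ''stop'' s]) = fst ` set (h1 @ [(i, r)]))"

definition scen_ok :: "search_instance \<Rightarrow> (nat \<times> nat) list \<Rightarrow> nat \<Rightarrow> state \<Rightarrow> bool" where
  "scen_ok I h s st \<longleftrightarrow>
     (nats st ''dead'' s = 0 \<longleftrightarrow> s \<in> remaining I {..<num_scens I} h) \<and>
     (s \<in> remaining I {..<num_scens I} h \<or> stop_ok I h s st)"

definition greedy_state :: "search_instance \<Rightarrow> (nat \<times> nat) list \<Rightarrow> state \<Rightarrow> bool" where
  "greedy_state I h st \<longleftrightarrow> greedy I {..<num_scens I} h \<and> fst ` set h \<subseteq> {..<boxes I} \<and>
     listing (fst ` set h) st \<and> (\<forall>s<num_scens I. scen_ok I h s st)"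

lemma exec_append_box_frame:
  "y \<notin> {''used'', ''order'', ''pos''} \<Longrightarrow> nats (exec I (append_box x) st) y = nats st y"
  by (auto simp: append_box_def)

lemma listing_append_box:
  assumes "listing B st" "x \<notin> {''used'', ''order'', ''pos''}"
  shows "listing (insert (nats st x 0) B) (exec I (append_box x) st)"
proof (cases "nats st x 0 \<in> B")
  case True
  then have "nats st ''used'' (nats st x 0) \<noteq> 0" using assms by (auto simp: listing_def)
  then have "exec I (append_box x) st = st" by (simp add: append_box_def)
  then show ?thesis using True assms by (simp add: insert_absorb)
next
  case False
  let ?o = "nats st ''order''" and ?p = "nats st ''pos'' 0" and ?b = "nats st x 0"
  have "map (?o(?p := ?b)) [0..<?p] = map ?o [0..<?p]" by (intro map_cong) auto
  then have "map (?o(?p := ?b)) [0..<Suc ?p] = map ?o [0..<?p] @ [?b]" by simp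
  moreover have "nats st ''used'' ?b = 0" using False assms by (auto simp: listing_def)
  ultimately show ?thesis using False assms
    by (auto simp: listing_def append_box_def simp del: upt_Suc)
qed

text \<open>A new box is written at position \<open>pos\<close>, at or beyond the recorded stopping
  time, so the prefix that \<open>stop_ok\<close> reads does not change.\<close>

lemma stop_ok_append_box:
  assumes "stop_ok I h s st" "x \<notin> {''used'', ''order'', ''pos''}"
  shows "stop_ok I h s (exec I (append_box x) st)"
proof (cases "nats st ''used'' (nats st x 0) = 0")
  case True
  let ?o = "nats st ''order''" and ?p = "nats st ''pos'' 0" and ?b = "nats st x 0" and ?t = "nats st ''stop'' s"
  have "map (?o(?p := ?b)) [0..<?t] = map ?o [0..<?t]" if "?t \<le> ?p"
    using that by (intro map_cong) auto
  then have "set (map (?o(?p := ?b)) [0..<?t]) = set (map ?o [0..<?t])" if "?t \<le> ?p"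
    using that by metis
  moreover have "nats (exec I (append_box x) st) ''order'' = ?o(?p := ?b)"
    "nats (exec I (append_box x) st) ''pos'' 0 = Suc ?p" "nats (exec I (append_box x) st) ''stop'' s = ?t"
    using True assms(2) by (auto simp: append_box_def)
  ultimately show ?thesis using assms(1) unfolding stop_ok_def
    by (metis le_SucI)
next
  case False
  then have "exec I (append_box x) st = st" by (simp add: append_box_def)
  then show ?thesis using assms by simp
qed

lemma stop_ok_snoc: "stop_ok I h s st \<Longrightarrow> stop_ok I (h @ [p]) s st"
  unfolding stop_ok_def by fastforce

lemma listing_cong:
  assumes "listing B st" "\<And>y. y \<in> {''order'', ''pos'', ''used''} \<Longrightarrow> nats st' y = nats st y"
  shows "listing B st'"
  using assms by (simp add: listing_def)

lemma stop_ok_cong: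
  assumes "stop_ok I h s st" "\<And>y. y \<in> {''order'', ''pos''} \<Longrightarrow> nats st' y = nats st y"
    "nats st' ''stop'' s = nats st ''stop'' s"
  shows "stop_ok I h s st'"
  using assms by (simp add: stop_ok_def)

lemma scen_ok_cong:
  assumes "scen_ok I h s st" "\<And>y. y \<in> {''order'', ''pos''} \<Longrightarrow> nats st' y = nats st y"
    "nats st' ''stop'' s = nats st ''stop'' s" "nats st' ''dead'' s = nats st ''dead'' s"
  shows "scen_ok I h s st'"
  using assms stop_ok_cong[OF _ assms(2,3)] by (auto simp: scen_ok_def)

lemma greedy_state_cong:
  assumes "greedy_state I h st"
    "\<And>y. y \<in> {''order'', ''pos'', ''used'', ''stop'', ''dead''} \<Longrightarrow> nats st' y = nats st y"
  shows "greedy_state I h st'"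
proof -
  have "listing (fst ` set h) st'"
    by (rule listing_cong[of _ st]) (use assms in \<open>auto simp: greedy_state_def\<close>)
  moreover have "scen_ok I h s st'" if "s < num_scens I" for s
    by (rule scen_ok_cong[of _ _ _ st]) (use assms that in \<open>auto simp: greedy_state_def\<close>)
  ultimately show ?thesis using assms(1) by (simp add: greedy_state_def)
qed

text \<open>For a scenario retired now, the witness in \<open>stop_ok\<close> splits the new history
  at its last pair, and \<open>listing\<close> identifies the prefix of length \<open>pos\<close>
  with the boxes of that history. In the other case the state is unchanged and the new pair does not
  affect whether \<open>j\<close> is uncovered.\<close>

lemma retire_scenario_ok:
  assumes ok: "scen_ok I h j st" and j: "nats st ''s'' 0 = j" "j < num_scens I"
    and b: "nats st ''bi'' 0 = b" "b < boxes I" and q: "nats st ''br'' 0 = q" "q < num_scens I"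
    and B: "listing (fst ` set (h @ [(b, q)])) st"
  shows "scen_ok I (h @ [(b, q)]) j (exec I retire_scenario st)"
proof (cases "nats st ''dead'' j = 0 \<and> cost I b j \<le> cost I b q")
  case True
  let ?st = "exec I retire_scenario st"
  have *: "nats ?st ''stop'' j = nats st ''pos'' 0" "nats ?st ''pos'' = nats st ''pos''"
    "nats ?st ''order'' = nats st ''order''" "nats ?st ''dead'' j = 1"
    using True j b q by (auto simp: retire_scenario_def not_less)
  have "j \<in> remaining I {..<num_scens I} h" using ok True by (simp add: scen_ok_def)
  then have "stop_ok I (h @ [(b, q)]) j ?st"
    unfolding stop_ok_def using True B
    by (intro exI[of _ h] exI[of _ b] exI[of _ q] exI[of _ "[]"]) (auto simp: * listing_def)
  moreover have "j \<notin> remaining I {..<num_scens I} (h @ [(b, q)])"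
    using True by (auto simp: remaining_def)
  ultimately show ?thesis by (simp add: scen_ok_def *)
next
  case False
  then have "exec I retire_scenario st = st" using j b q by (auto simp: retire_scenario_def not_less)
  moreover have "j \<in> remaining I {..<num_scens I} (h @ [(b, q)]) \<longleftrightarrow> j \<in> remaining I {..<num_scens I} h"
    using False ok by (auto simp: remaining_snoc covered_def scen_ok_def)
  ultimately show ?thesis using ok stop_ok_snoc by (auto simp: scen_ok_def)
qed

lemma hoare_commit:
  assumes gc: "greedy_choice I (remaining I {..<num_scens I} h) b q" and q: "q < num_scens I"
  shows "hoare I (\<lambda>st. greedy_state I h st \<and> nats st ''t'' 0 = t \<and> nats st ''bi'' 0 = b \<and> nats st ''br'' 0 = q)
    (Seq (append_box ''bi'') (For ''s'' NumScens retire_scenario)) (num_scens I * 15 + 20)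
    (\<lambda>st. greedy_state I (h @ [(b, q)]) st \<and> nats st ''t'' 0 = t)"
proof -
  let ?h = "h @ [(b, q)]" and ?S = "num_scens I"
  have b: "b < boxes I" using gc by (simp add: greedy_choice_def)
  \<comment> \<open>Midway through the loop, the scenarios below \<open>j\<close> refer to the
    extended history and the others still to \<open>h\<close>.\<close>
  define Inv where "Inv j st \<longleftrightarrow> greedy I {..<?S} ?h \<and> fst ` set ?h \<subseteq> {..<boxes I} \<and>
    listing (fst ` set ?h) st \<and> nats st ''t'' 0 = t \<and> nats st ''bi'' 0 = b \<and> nats st ''br'' 0 = q \<and>
    (\<forall>s<j. scen_ok I ?h s st) \<and> (\<forall>s<?S. j \<le> s \<longrightarrow> scen_ok I h s st)" for j st
  have init: "Inv 0 (exec I (append_box ''bi'') st)"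
    if st: "greedy_state I h st \<and> nats st ''t'' 0 = t \<and> nats st ''bi'' 0 = b \<and> nats st ''br'' 0 = q" for st
  proof -
    have "listing (fst ` set ?h) (exec I (append_box ''bi'') st)"
      using st listing_append_box[of "fst ` set h" st "''bi''" I] by (simp add: greedy_state_def)
    moreover have "scen_ok I h s (exec I (append_box ''bi'') st)" if "s < ?S" for s
      using st that stop_ok_append_box[of I h s st "''bi''"]
      by (auto simp: greedy_state_def scen_ok_def exec_append_box_frame)
    ultimately show ?thesis
      using st gc b by (auto simp: Inv_def exec_append_box_frame greedy_snoc greedy_state_def)
  qed
  have body: "hoare I (\<lambda>st. Inv j st \<and> nats st ''s'' 0 = j) retire_scenario 4
      (\<lambda>st. Inv (Suc j) st \<and> nats st ''s'' 0 = j)" if j: "j < ?S" for j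
  proof (rule hoare_exec)
    fix st assume st: "Inv j st \<and> nats st ''s'' 0 = j"
    let ?st = "exec I retire_scenario st"
    have same: "nats ?st y = nats st y" if "y \<noteq> ''stop''" "y \<noteq> ''dead''" for y
      using that by (auto simp: retire_scenario_def)
    have other: "nats ?st ''stop'' s = nats st ''stop'' s" "nats ?st ''dead'' s = nats st ''dead'' s"
      if "s \<noteq> j" for s
      using that st by (auto simp: retire_scenario_def)
    have keep: "scen_ok I h' s ?st" if "scen_ok I h' s st" "s \<noteq> j" for h' s
      by (rule scen_ok_cong[OF that(1)]) (auto simp: same other that(2))
    have "scen_ok I ?h j ?st"
      using st j b q by (intro retire_scenario_ok) (auto simp: Inv_def)
    moreover have "listing (fst ` set ?h) ?st"
      by (rule listing_cong[of _ st]) (use st in \<open>auto simp: same Inv_def\<close>)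
    ultimately show "Inv (Suc j) ?st \<and> nats ?st ''s'' 0 = j"
      using st keep by (auto simp: Inv_def same less_Suc_eq)
  qed (simp_all add: retire_scenario_def)
  have frame: "Inv j (set_nat ''s'' 0 v st)" if "Inv j st" for j v st
  proof -
    let ?st = "set_nat ''s'' 0 v st"
    have "listing B ?st" if "listing B st" for B
      by (rule listing_cong[OF that]) auto
    moreover have "scen_ok I h' s ?st" if "scen_ok I h' s st" for h' s
      by (rule scen_ok_cong[OF that]) auto
    ultimately show ?thesis using that by (auto simp: Inv_def)
  qed
  have loop: "hoare I (Inv 0) (For ''s'' NumScens retire_scenario) (?S * (4 + 5) + 4) (Inv ?S)"
    by (rule hoare_For[OF body frame]) auto
  have "hoare I (\<lambda>st. greedy_state I h st \<and> nats st ''t'' 0 = t \<and> nats st ''bi'' 0 = b \<and> nats st ''br'' 0 = q)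
    (Seq (append_box ''bi'') (For ''s'' NumScens retire_scenario)) (6 + (?S * (4 + 5) + 4) + 1) (Inv ?S)"
    by (rule hoare_Seq[OF _ loop], rule hoare_exec) (use init in \<open>auto simp: append_box_def\<close>)
  then show ?thesis by (rule hoare_conseq) (auto simp: Inv_def greedy_state_def)
qed

abbreviation iteration_time :: "nat \<Rightarrow> nat \<Rightarrow> nat" where
  "iteration_time n m \<equiv> n * (m * (m * 20 + 30) + 10) + m * 15 + 50"

text \<open>The history is a ghost value, hence existentially quantified. A greedy choice covers
  something as long as a scenario is uncovered, so the bound on their number falls by one per round,
  until it is 0 after \<open>num_scens I\<close> rounds.\<close>

lemma hoare_iteration:
  assumes I: "valid_instance I"
  shows "hoare I
    (\<lambda>st. (\<exists>h. greedy_state I h st \<and> card (remaining I {..<num_scens I} h) \<le> num_scens I - t) \<and> nats st ''t'' 0 = t)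
    (Seq search (Seq (append_box ''bi'') (For ''s'' NumScens retire_scenario)))
    (iteration_time (boxes I) (num_scens I))
    (\<lambda>st. (\<exists>h. greedy_state I h st \<and> card (remaining I {..<num_scens I} h) \<le> num_scens I - Suc t) \<and> nats st ''t'' 0 = t)"
    (is "hoare I ?P ?c ?k ?Q")
proof -
  let ?S = "num_scens I" and ?n = "boxes I"
  have single: "hoare I (\<lambda>st. greedy_state I h st \<and> nats st ''t'' 0 = t) ?c ?k ?Q"
    if h: "card (remaining I {..<?S} h) \<le> ?S - t" for h
  proof -
    let ?R = "remaining I {..<?S} h"
    have R: "?R \<subseteq> {..<?S}" by (auto simp: remaining_def)
    then have finR: "finite ?R" using finite_subset by blast
    have fr: "greedy_state I h (set_nat x 0 v st)"
      if "x \<in> {''s'', ''cnt'', ''i'', ''r'', ''bcnt'', ''bi'', ''br''}" "greedy_state I h st" for x v st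
      by (rule greedy_state_cong[OF that(2)]) (use that(1) in auto)
    have fr': "greedy_state I h (set_real x 0 v st)" if "greedy_state I h st" for x v st
      by (rule greedy_state_cong[OF that]) auto
    have "hoare I (\<lambda>st. greedy_state I h st \<and> nats st ''t'' 0 = t) search
      (?n * (?S * (?S * 20 + 30) + 10) + 20)
      (\<lambda>st. (greedy_state I h st \<and> nats st ''t'' 0 = t) \<and>
        greedy_choice I ?R (nats st ''bi'' 0) (nats st ''br'' 0) \<and> nats st ''br'' 0 < ?S)"
    proof (rule hoare_search[OF I R])
      show "\<forall>s<?S. nats st ''dead'' s = 0 \<longleftrightarrow> s \<in> ?R" if "greedy_state I h st \<and> nats st ''t'' 0 = t" for st
        using that by (simp add: greedy_state_def scen_ok_def)
    qed (auto simp: fr fr')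
    moreover have "hoare I
      (\<lambda>st. \<exists>b q. (greedy_choice I ?R b q \<and> q < ?S) \<and>
        (greedy_state I h st \<and> nats st ''t'' 0 = t \<and> nats st ''bi'' 0 = b \<and> nats st ''br'' 0 = q))
      (Seq (append_box ''bi'') (For ''s'' NumScens retire_scenario)) (?S * 15 + 20) ?Q"
    proof (rule hoare_ex, rule hoare_ex, rule hoare_conj_const)
      fix b q assume bq: "greedy_choice I ?R b q \<and> q < ?S"
      have "card (remaining I {..<?S} (h @ [(b, q)])) \<le> ?S - Suc t"
      proof (cases "?R = {}")
        case True
        then show ?thesis by (simp add: remaining_snoc)
      next
        case False
        then have "covered I ?R b q \<noteq> {}" using bq by (simp add: greedy_choice_def)
        then have "card (?R - covered I ?R b q) < card ?R"
          using finR covered_subset[of I ?R b q] by (intro psubset_card_mono) auto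
        then show ?thesis using h by (simp add: remaining_snoc)
      qed
      then show "hoare I (\<lambda>st. greedy_state I h st \<and> nats st ''t'' 0 = t \<and> nats st ''bi'' 0 = b \<and> nats st ''br'' 0 = q)
          (Seq (append_box ''bi'') (For ''s'' NumScens retire_scenario)) (?S * 15 + 20) ?Q"
        using bq by (intro hoare_conseq[OF hoare_commit[of I h b q t]]) auto
    qed
    then have "hoare I
      (\<lambda>st. (greedy_state I h st \<and> nats st ''t'' 0 = t) \<and>
        greedy_choice I ?R (nats st ''bi'' 0) (nats st ''br'' 0) \<and> nats st ''br'' 0 < ?S)
      (Seq (append_box ''bi'') (For ''s'' NumScens retire_scenario)) (?S * 15 + 20) ?Q"
      by (rule hoare_conseq) auto
    ultimately have "hoare I (\<lambda>st. greedy_state I h st \<and> nats st ''t'' 0 = t) ?c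
      (?n * (?S * (?S * 20 + 30) + 10) + 20 + (?S * 15 + 20) + 1) ?Q"
      by (rule hoare_Seq)
    then show ?thesis by (rule hoare_conseq) auto
  qed
  have "hoare I (\<lambda>st. \<exists>h. card (remaining I {..<?S} h) \<le> ?S - t \<and> greedy_state I h st \<and> nats st ''t'' 0 = t) ?c ?k ?Q"
    by (rule hoare_ex, rule hoare_conj_const, rule single)
  then show ?thesis by (rule hoare_conseq) auto
qed

text \<open>The set \<open>B\<close> of listed boxes is kept apart from the history, because
  completing the order adds boxes that no pair has chosen.\<close>

definition solved :: "search_instance \<Rightarrow> (nat \<times> nat) list \<Rightarrow> nat set \<Rightarrow> state \<Rightarrow> bool" where
  "solved I h B st \<longleftrightarrow> greedy I {..<num_scens I} h \<and> fst ` set h \<subseteq> {..<boxes I} \<and>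
     remaining I {..<num_scens I} h = {} \<and> listing B st \<and> (\<forall>s<num_scens I. stop_ok I h s st)"

abbreviation program_time :: "nat \<Rightarrow> nat \<Rightarrow> nat" where
  "program_time n m \<equiv> m * (iteration_time n m + 5) + 4 + (n * (6 + 5) + 4) + 1"

lemma hoare_greedy_program:
  assumes I: "valid_instance I"
  shows "hoare I (\<lambda>st. st = init_state) greedy_program (program_time (boxes I) (num_scens I))
    (\<lambda>st. \<exists>h. solved I h {..<boxes I} st)"
proof -
  let ?S = "num_scens I" and ?n = "boxes I"
  have "hoare I (\<lambda>st. \<exists>h. greedy_state I h st \<and> card (remaining I {..<?S} h) \<le> ?S - 0)
     (For ''t'' NumScens (Seq search (Seq (append_box ''bi'') (For ''s'' NumScens retire_scenario))))
     (?S * (iteration_time ?n ?S + 5) + 4)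
     (\<lambda>st. \<exists>h. greedy_state I h st \<and> card (remaining I {..<?S} h) \<le> ?S - ?S)"
  proof (rule hoare_For[OF hoare_iteration[OF I]])
    fix j v st assume "\<exists>h. greedy_state I h st \<and> card (remaining I {..<?S} h) \<le> ?S - j"
    then obtain h where h: "greedy_state I h st" "card (remaining I {..<?S} h) \<le> ?S - j" by blast
    have "greedy_state I h (set_nat ''t'' 0 v st)" by (rule greedy_state_cong[OF h(1)]) auto
    then show "\<exists>h. greedy_state I h (set_nat ''t'' 0 v st) \<and> card (remaining I {..<?S} h) \<le> ?S - j"
      using h by blast
  qed auto
  then have 1: "hoare I (\<lambda>st. st = init_state)
     (For ''t'' NumScens (Seq search (Seq (append_box ''bi'') (For ''s'' NumScens retire_scenario))))
     (?S * (iteration_time ?n ?S + 5) + 4)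
     (\<lambda>st. \<exists>h. solved I h (fst ` set h) st)"
  proof (rule hoare_conseq)
    fix st assume "st = init_state"
    then have "greedy_state I [] st"
      by (auto simp: greedy_state_def init_state_def listing_def scen_ok_def)
    then show "\<exists>h. greedy_state I h st \<and> card (remaining I {..<?S} h) \<le> ?S - 0"
      by (intro exI[of _ "[]"]) auto
  next
    fix st assume "\<exists>h. greedy_state I h st \<and> card (remaining I {..<?S} h) \<le> ?S - ?S"
    then obtain h where h: "greedy_state I h st" "card (remaining I {..<?S} h) = 0" by auto
    moreover have "finite (remaining I {..<?S} h)" by (simp add: remaining_def)
    ultimately show "\<exists>h. solved I h (fst ` set h) st"
      by (intro exI[of _ h]) (auto simp: solved_def greedy_state_def scen_ok_def)
  qed auto
  have "hoare I (\<lambda>st. \<exists>h. solved I h (fst ` set h \<union> {..<0}) st) (For ''i'' NumBoxes (append_box ''i''))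
     (?n * (6 + 5) + 4) (\<lambda>st. \<exists>h. solved I h (fst ` set h \<union> {..<?n}) st)"
  proof (rule hoare_For)
    fix j assume j: "j < ?n"
    show "hoare I (\<lambda>st. (\<exists>h. solved I h (fst ` set h \<union> {..<j}) st) \<and> nats st ''i'' 0 = j) (append_box ''i'') 6
        (\<lambda>st. (\<exists>h. solved I h (fst ` set h \<union> {..<Suc j}) st) \<and> nats st ''i'' 0 = j)"
    proof (rule hoare_exec)
      fix st assume "(\<exists>h. solved I h (fst ` set h \<union> {..<j}) st) \<and> nats st ''i'' 0 = j"
      then obtain h where h: "solved I h (fst ` set h \<union> {..<j}) st" "nats st ''i'' 0 = j" by blast
      have "insert j (fst ` set h \<union> {..<j}) = fst ` set h \<union> {..<Suc j}" by auto
      then have "solved I h (fst ` set h \<union> {..<Suc j}) (exec I (append_box ''i'') st)"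
        using h listing_append_box[of "fst ` set h \<union> {..<j}" st "''i''" I] stop_ok_append_box[of I h _ st "''i''"]
        by (auto simp: solved_def)
      then show "(\<exists>h. solved I h (fst ` set h \<union> {..<Suc j}) (exec I (append_box ''i'') st)) \<and>
          nats (exec I (append_box ''i'') st) ''i'' 0 = j"
        using h by (auto simp: exec_append_box_frame)
    qed (simp_all add: append_box_def)
  next
    fix j v st assume "\<exists>h. solved I h (fst ` set h \<union> {..<j}) st"
    then obtain h where h: "solved I h (fst ` set h \<union> {..<j}) st" by blast
    have "solved I h (fst ` set h \<union> {..<j}) (set_nat ''i'' 0 v st)"
    proof -
      let ?st = "set_nat ''i'' 0 v st"
      have "listing B ?st" if "listing B st" for B
        by (rule listing_cong[OF that]) auto
      moreover have "stop_ok I h s ?st" if "stop_ok I h s st" for s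
        by (rule stop_ok_cong[OF that]) auto
      ultimately show ?thesis using h by (auto simp: solved_def)
    qed
    then show "\<exists>h. solved I h (fst ` set h \<union> {..<j}) (set_nat ''i'' 0 v st)" by blast
  qed auto
  then have 2: "hoare I (\<lambda>st. \<exists>h. solved I h (fst ` set h) st) (For ''i'' NumBoxes (append_box ''i''))
     (?n * (6 + 5) + 4) (\<lambda>st. \<exists>h. solved I h {..<?n} st)"
    by (rule hoare_conseq) (auto simp: solved_def Un_absorb1)
  show ?thesis unfolding greedy_program_def by (rule hoare_Seq[OF 1 2])
qed

section \<open>The output strategy\<close>

text \<open>This is \<open>program_time\<close> with both arguments replaced by the sum of the two
  sizes. Keeping its shape makes the comparison a term-by-term monotonicity argument.\<close>

definition time_poly :: "nat poly" where
  "time_poly = (let m = [:0, 1:] in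
     m * (m * (m * (m * [:20:] + [:30:]) + [:10:]) + m * [:15:] + [:50:] + [:5:]) + [:4:] + (m * [:11:] + [:4:]) + [:1:])"

lemma program_time_le: "program_time n m \<le> poly time_poly (n + m)"
  unfolding time_poly_def Let_def
  by (simp only: poly_add poly_mult poly_pCons poly_0 mult_zero_right mult_1_right add_0_left add_0_right)
    (intro add_mono mult_mono; simp)

lemma observed_nth_eq:
  assumes "observed I xs s t = observed I xs s' t" "i \<in> set (take t xs)"
  shows "cost I i s = cost I i s'"
  using assms unfolding observed_def by (auto simp: map_eq_conv)

lemma remaining_prefix:
  assumes "s \<in> remaining I R h" "h = h1 @ h2"
  shows "s \<in> remaining I R h1"
  using assms by (auto simp: remaining_def)

text \<open>A scenario that has been covered by the pair (i, r) is indistinguishable from s only if s has the same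
  cost in box i, so that s has been covered by then as well.\<close>

lemma output_strategy_correct:
  assumes I: "valid_instance I" and sv: "solved I h {..<boxes I} st" and s: "s < num_scens I"
  shows "valid_strategy I (output_strategy I st)"
    "total_cost I (output_strategy I st) s \<le> paid I h s"
proof -
  let ?\<sigma> = "output_strategy I st" and ?n = "boxes I" and ?S = "{..<num_scens I}"
  let ?stop = "nats st ''stop''"
  define xs where "xs = map (nats st ''order'') [0..<?n]"
  have listing: "listing {..<?n} st" using sv by (simp add: solved_def)
  then have "card {..<?n} = nats st ''pos'' 0"
    unfolding listing_def by (metis distinct_card length_map length_upt minus_nat.diff_0)
  then have pos: "nats st ''pos'' 0 = ?n" by simp
  have xs: "distinct xs" "set xs = {..<?n}" "length xs = ?n"
    using listing unfolding listing_def pos xs_def by auto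
  have order: "probe_order ?\<sigma> = xs"
    by (simp add: output_strategy_def Let_def xs_def)
  have stop: "stop ?\<sigma> hs \<longleftrightarrow> (\<exists>q<num_scens I. observed I xs q (length hs) = hs \<and> ?stop q \<le> length hs)" for hs
    by (simp add: output_strategy_def Let_def xs_def)
  show valid: "valid_strategy I ?\<sigma>" using xs by (simp add: valid_strategy_def order)
  have n: "1 \<le> ?n" using I by (simp add: valid_instance_def)
  have served: "\<exists>h1 i r h2. h = h1 @ (i, r) # h2 \<and> q \<in> remaining I ?S h1 \<and> cost I i q \<le> cost I i r \<and>
      ?stop q \<le> ?n \<and> set (take (?stop q) xs) = fst ` set (h1 @ [(i, r)])"
    if "q < num_scens I" for q
  proof -
    have "stop_ok I h q st" using sv that by (simp add: solved_def)
    then obtain h1 i r h2 where *: "h = h1 @ (i, r) # h2" "q \<in> remaining I ?S h1" "cost I i q \<le> cost I i r"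
      "?stop q \<le> ?n" "set (map (nats st ''order'') [0..<?stop q]) = fst ` set (h1 @ [(i, r)])"
      unfolding stop_ok_def pos by blast
    have "take (?stop q) xs = map (nats st ''order'') [0..<?stop q]"
      using *(4) by (simp add: xs_def take_map)
    then show ?thesis using * by metis
  qed
  have card_take: "card (set (take t xs)) = t" if "t \<le> ?n" for t
    using distinct_card[OF distinct_take[OF xs(1)], of t] xs(3) that by simp
  obtain h1 i r h2 where s': "h = h1 @ (i, r) # h2" "s \<in> remaining I ?S h1" "cost I i s \<le> cost I i r"
    "?stop s \<le> ?n" "set (take (?stop s) xs) = fst ` set (h1 @ [(i, r)])"
    using served[OF s] by blast
  \<comment> \<open>Repeated boxes count once here but once per pair in \<open>paid\<close>, hence
    only an inequality in the next step.\<close>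
  have "?stop s = card (fst ` set (h1 @ [(i, r)]))" using card_take[OF s'(4)] s'(5) by simp
  also have "\<dots> \<le> length (h1 @ [(i, r)])" by (meson card_image_le card_length finite_set order_trans)
  finally have stop_le: "?stop s \<le> Suc (length h1)" by simp
  have stop_pos: "1 \<le> ?stop s" using s'(5) by (cases "?stop s") auto
  let ?t = "num_probes I ?\<sigma> s"
  \<comment> \<open>The scenario \<open>s\<close> is consistent with its own observations, so its
    recorded time triggers the rule.\<close>
  have t_le: "?t \<le> ?stop s"
    unfolding num_probes_def
  proof (rule Least_le, intro conjI disjI1)
    have "length (observed I xs s (?stop s)) = ?stop s" using s'(4) xs(3) by (simp add: observed_def)
    then show "stop ?\<sigma> (observed I (probe_order ?\<sigma>) s (?stop s))"
      unfolding stop order using s by auto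
  qed (rule stop_pos)
  have t_ge: "?stop s \<le> ?t"
  proof (cases "?t < ?n")
    case False
    then show ?thesis using s'(4) by simp
  next
    case True
    then have "stop ?\<sigma> (observed I xs s ?t)" using num_probes_bounds(3)[OF n] order by metis
    moreover have "length (observed I xs s ?t) = ?t" using True xs(3) by (simp add: observed_def)
    ultimately obtain q where q: "q < num_scens I" "observed I xs q ?t = observed I xs s ?t" "?stop q \<le> ?t"
      unfolding stop by auto
    obtain g1 j p g2 where q': "h = g1 @ (j, p) # g2" "cost I j q \<le> cost I j p"
      "?stop q \<le> ?n" "set (take (?stop q) xs) = fst ` set (g1 @ [(j, p)])"
      using served[OF q(1)] by blast
    have "j \<in> set (take (?stop q) xs)" using q'(4) by simp
    then have "j \<in> set (take ?t xs)" by (rule subsetD[OF set_take_subset_set_take[OF q(3)]])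
    then have "cost I j q = cost I j s" using observed_nth_eq[OF q(2)] by blast
    \<comment> \<open>If \<open>(j, p)\<close> came strictly before the pair that covers
      \<open>s\<close>, then \<open>s\<close> would not have remained after
      \<open>h1\<close>.\<close>
    then have "s \<notin> remaining I ?S (g1 @ [(j, p)])" using q'(2) by (auto simp: remaining_def)
    moreover have "h1 = (g1 @ [(j, p)]) @ drop (Suc (length g1)) h1" if "Suc (length g1) \<le> length h1"
    proof -
      have "take (Suc (length g1)) h = g1 @ [(j, p)]" using q'(1) by simp
      moreover have "take (Suc (length g1)) h = take (Suc (length g1)) h1" using s'(1) that by simp
      ultimately show ?thesis by (metis append_take_drop_id)
    qed
    ultimately have "length h1 \<le> length g1"
      using remaining_prefix[OF s'(2)] by (meson not_less_eq_eq)
    then have "h1 @ [(i, r)] = take (Suc (length h1)) (g1 @ [(j, p)])"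
    proof -
      assume le: "length h1 \<le> length g1"
      have "h1 @ [(i, r)] = take (Suc (length h1)) h" using s'(1) by simp
      also have "\<dots> = take (Suc (length h1)) (take (Suc (length g1)) h)" using le by simp
      also have "take (Suc (length g1)) h = g1 @ [(j, p)]" using q'(1) by simp
      finally show ?thesis .
    qed
    \<comment> \<open>The history up to the covering of \<open>s\<close> is a prefix of that for
      \<open>q\<close>, so it involves at most as many distinct boxes, and these numbers are the
      stopping times.\<close>
    then have "set (h1 @ [(i, r)]) \<subseteq> set (g1 @ [(j, p)])" by (metis set_take_subset)
    then have "set (take (?stop s) xs) \<subseteq> set (take (?stop q) xs)"
      unfolding s'(5) q'(4) by (rule image_mono)
    then have "card (set (take (?stop s) xs)) \<le> card (set (take (?stop q) xs))" by (intro card_mono) auto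
    then have "?stop s \<le> ?stop q" using card_take s'(4) q'(3) by simp
    then show ?thesis using q(3) by simp
  qed
  have t: "?t = ?stop s" using t_le t_ge by simp
  have "cost I i s \<in> set (observed I xs s (?stop s))"
    unfolding observed_def set_map using s'(5) by auto
  then have "Min (set (observed I xs s (?stop s))) \<le> cost I i s" by (intro Min_le) auto
  then have "total_cost I ?\<sigma> s \<le> real (Suc (length h1)) + cost I i s"
    unfolding total_cost_def t order using stop_le by linarith
  also have "\<dots> = paid I h s" using paid_append[OF s'(2,3)] s'(1) by simp
  finally show "total_cost I ?\<sigma> s \<le> paid I h s" .
qed

section \<open>Approximation factor\<close>

lemma expected_cost_eq:
  assumes "scenarios I \<noteq> []"
  shows "expected_cost I \<sigma> = (\<Sum>s<num_scens I. total_cost I \<sigma> s) / num_scens I"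
  unfolding expected_cost_def using assms by (subst integral_pmf_of_set) auto

lemma valid_strategy_exists: "\<exists>\<sigma>. valid_strategy I \<sigma>"
  by (rule exI[of _ "\<lparr>probe_order = [0..<boxes I], stop = (\<lambda>_. False)\<rparr>"]) (auto simp: valid_strategy_def)

lemma expected_cost_le_pa_opt:
  assumes I: "valid_instance I" and sv: "solved I h {..<boxes I} st"
  shows "expected_cost I (output_strategy I st) \<le> 6 * pa_opt I"
proof -
  have ne: "scenarios I \<noteq> []" using I by (simp add: valid_instance_def)
  have "expected_cost I (output_strategy I st) / 6 \<le> pa_opt I"
    unfolding pa_opt_def
  proof (rule cINF_greatest)
    show "{\<sigma>. valid_strategy I \<sigma>} \<noteq> {}" using valid_strategy_exists by blast
  next
    fix \<sigma> assume "\<sigma> \<in> {\<sigma>. valid_strategy I \<sigma>}"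
    then have \<sigma>: "valid_strategy I \<sigma>" by simp
    have "(\<Sum>s<num_scens I. total_cost I (output_strategy I st) s) \<le> (\<Sum>s<num_scens I. paid I h s)"
      using output_strategy_correct(2)[OF I sv] by (intro sum_mono) auto
    also have "\<dots> \<le> 6 * (\<Sum>s<num_scens I. total_cost I \<sigma> s)"
      using sv by (intro sum_paid_le[OF I \<sigma>]) (auto simp: solved_def)
    finally show "expected_cost I (output_strategy I st) / 6 \<le> expected_cost I \<sigma>"
      using ne by (simp add: expected_cost_eq field_simps)
  qed
  then show ?thesis by simp
qed

lemma pa_opt_nonneg:
  assumes "valid_instance I"
  shows "0 \<le> pa_opt I"
  unfolding pa_opt_def
proof (rule cINF_greatest)
  show "{\<sigma>. valid_strategy I \<sigma>} \<noteq> {}" using valid_strategy_exists by blast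
  show "0 \<le> expected_cost I \<sigma>" if "\<sigma> \<in> {\<sigma>. valid_strategy I \<sigma>}" for \<sigma>
    using that assms total_cost_nonneg[OF assms]
    by (auto simp: expected_cost_eq valid_instance_def intro!: divide_nonneg_nonneg sum_nonneg)
qed

text \<open>The crude bounds \<open>exp 1 \<le> 3\<close> and \<open>1 \<le> sqrt 2\<close> already
  give 7.5, since \<open>x / (x - 1)\<close> decreases for \<open>x\<close> above 1.\<close>

lemma six_le_ratio: "6 \<le> (3 + 2 * sqrt 2) * (exp 1 / (exp 1 - 1) :: real)"
proof -
  have e: "1 < exp (1::real)" "exp (1::real) \<le> 3" using exp_le by auto
  then have "3 / 2 \<le> exp 1 / (exp 1 - 1 :: real)" by (simp add: field_simps)
  moreover have "1 \<le> sqrt 2" by simp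
  ultimately have "5 * (3 / 2) \<le> (3 + 2 * sqrt 2) * (exp 1 / (exp 1 - 1) :: real)"
    by (intro mult_mono) auto
  then show ?thesis by simp
qed

theorem mainTheorem5:
  "\<exists>(alg :: com) (p :: nat poly). \<forall>I :: search_instance. valid_instance I \<longrightarrow>
     (let T = poly p (boxes I + num_scens I); R = output_distribution I alg T in
        halts_within I alg T \<and>
        (\<forall>\<sigma>\<in>set_pmf R. valid_strategy I \<sigma>) \<and>
        rand_expected_cost I R \<le> (3 + 2 * sqrt 2) * (exp 1 / (exp 1 - 1)) * pa_opt I)"
proof (intro exI[of _ greedy_program] exI[of _ time_poly] allI impI)
  fix I assume I: "valid_instance I"
  define T where "T = poly time_poly (boxes I + num_scens I)"
  obtain m st where m: "m \<le> program_time (boxes I) (num_scens I)"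
    "(dstep I ^^ m) (greedy_program, init_state) (Skip, st)" and "\<exists>h. solved I h {..<boxes I} st"
    using hoare_greedy_program[OF I] by (elim hoareE) auto
  then obtain h where sv: "solved I h {..<boxes I} st" by blast
  have "m \<le> T" unfolding T_def using m(1) program_time_le by (rule order_trans)
  then have run: "run I greedy_program T = return_pmf (Skip, st)"
    using run_Skip run_dstep m(2) by blast
  \<comment> \<open>The program is deterministic, so the distribution over strategies is a point
    mass and its expectation is a single value.\<close>
  then have R: "output_distribution I greedy_program T = return_pmf (output_strategy I st)"
    by (simp add: output_distribution_def)
  have "0 < num_scens I" using I by (simp add: valid_instance_def)
  then have "valid_strategy I (output_strategy I st)" using output_strategy_correct(1)[OF I sv] by blast
  moreover have "expected_cost I (output_strategy I st) \<le>
      (3 + 2 * sqrt 2) * (exp 1 / (exp 1 - 1)) * pa_opt I"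
    using expected_cost_le_pa_opt[OF I sv] mult_right_mono[OF six_le_ratio pa_opt_nonneg[OF I]]
    by linarith
  ultimately show "let T = poly time_poly (boxes I + num_scens I);
        R = output_distribution I greedy_program T in
      halts_within I greedy_program T \<and> (\<forall>\<sigma>\<in>set_pmf R. valid_strategy I \<sigma>) \<and>
      rand_expected_cost I R \<le> (3 + 2 * sqrt 2) * (exp 1 / (exp 1 - 1)) * pa_opt I"
    unfolding Let_def T_def[symmetric] R by (simp add: halts_within_def run rand_expected_cost_def)
qed

end
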